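(* Let $p$ be a prime other than $2$ or $3$, let $\mathbb{F}$ be any field of characteristic $p$, and let $V=\bigoplus_{t\in\mathbb{F}_{13}}V_t$ be the $78$-dimensional $\mathbb{F}$-vector space, and $G=\langle a,b,c,d,e\rangle$ the group of $\mathbb{F}$-linear automorphisms of $V$, defined in the context. Then, up to scalar multiplication by elements of $\mathbb{F}$, there is a unique (non-zero) $\mathbb{F}$-bilinear product $[\cdot,\cdot]:V\times V\to V$ which is invariant under $G$. This product is defined by (that is, when suitably scaled it is the unique $G$-invariant $\mathbb{F}$-bilinear product satisfying) $$[(1,0,0)_0,(1,0,0)_1]=(\overline{\omega},1,1)_3-(1,\overline{\omega},\overline{\omega})_9,$$ it is anti-symmetric, and it satisfies the Jacobi identity $[[x,y],z]+[[y,z],x]+[[z,x],y]=0$ for all $x,y,z\in V$.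
   Context: Let $K=\mathbb{F}[\omega]/(\omega^2+\omega+1)$, a commutative $\mathbb{F}$-algebra with $\mathbb{F}$-basis $\{1,\omega\}$ (it need not be a field; $\omega$ is not to be confused with an element of order $3$ in $\mathbb{F}$, if there is one). Let $x\mapsto\overline{x}$ be the $\mathbb{F}$-algebra automorphism of $K$ with $\overline{\omega}=\omega^2=-1-\omega$, and let $\theta=\omega-\overline{\omega}$ (so $\theta^2=-3$). For each $t\in\mathbb{F}_{13}=\{0,1,\dots,12\}$ let $V_t$ be a copy of $K^3$, regarded as a $6$-dimensional $\mathbb{F}$-vector space; for $v\in K^3$ write $v_t$ for the corresponding vector of $V_t$. Let $V=\bigoplus_{t}V_t$ ($\mathbb{F}$-dimension $78$). Vectors of $K^3$ are row vectors; a matrix acts on them by right multiplication, and $v_tM$ means $(vM)_t$. All maps and products are $\mathbb{F}$-(bi)linear. Group elements act on the right (products $gh$ mean first $g$, then $h$). Define $\mathbb{F}$-linear automorphisms of $V$ as follows (subscripts mod $13$). $a$: $v_t\mapsto v_{t+1}$. $b$: $(x,y,z)_t\mapsto(\omega x,\overline{\omega}y,\overline{\omega}z)_{3t}$. $c$: with $$M_1=\tfrac{\theta}{3}\begin{pmatrix}\omega&1&1\\1&\omega&1\\1&1&\omega\end{pmatrix},\ M_2=\tfrac{\theta}{3}\begin{pmatrix}1&1&1\\1&\overline{\omega}&\omega\\1&\omega&\overline{\omega}\end{pmatrix},\ M_3=\tfrac{\theta}{3}\begin{pmatrix}\omega&\omega&\omega\\\overline{\omega}&\omega&1\\\overline{\omega}&1&\omega\end{pmatrix},\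 M_4=\tfrac{\theta}{3}\begin{pmatrix}1&\omega&\omega\\\overline{\omega}&\overline{\omega}&\omega\\\overline{\omega}&\omega&\overline{\omega}\end{pmatrix},$$ $c$ maps $(x,y,z)_0\mapsto-(\overline{x},\overline{z},\overline{y})_0$; $(x,y,z)_1\mapsto-(x,z,y)_1$; $(x,y,z)_3\mapsto-(\omega x,\overline{\omega}z,\overline{\omega}y)_9$; $(x,y,z)_9\mapsto-(\overline{\omega}x,\omega z,\omega y)_3$; $(x,y,z)_4\mapsto(\overline{x},\overline{y},\overline{z})_{10}$; $(x,y,z)_{10}\mapsto(\overline{x},\overline{y},\overline{z})_4$; $(x,y,z)_{12}\mapsto(\overline{x},\overline{y},\overline{z})_{12}$; $(x,y,z)_2\mapsto(\overline{x},\overline{y},\overline{z})_2M_1$; $(x,y,z)_8\mapsto(\overline{x},\overline{y},\overline{z})_8M_2$; $(x,y,z)_5\mapsto(\overline{x},\overline{y},\overline{z})_6M_3$; $(x,y,z)_6\mapsto(\overline{x},\overline{y},\overline{z})_5M_3^{\top}$; $(x,y,z)_7\mapsto(\overline{x},\overline{y},\overline{z})_{11}M_4$; $(x,y,z)_{11}\mapsto(\overline{x},\overline{y},\overline{z})_7M_4^{\top}$. $d$: $v_t\mapsto\delta_tv_t$ where $(\delta_0,\dots,\delta_{12})=(1,\omega,1,\omega,\omega,\omega,\overline{\omega},\overline{\omega},1,\omega,\overline{\omega},\omega,1)$. $e$: $(x,y,z)_0\mapsto(x,y,z)_0$; $(x,y,z)_t\mapsto(z,x,y)_t$ for $t=1,11$;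 $(x,y,z)_2\mapsto(\overline{\omega}y,z,\omega x)_2$; $(x,y,z)_t\mapsto(\overline{\omega}z,\omega x,y)_t$ for $t=3,7$; $(x,y,z)_t\mapsto(x,\omega y,\overline{\omega}z)_t$ for $t=4,10,12$; $(x,y,z)_5\mapsto(y,z,x)_5$; $(x,y,z)_6\mapsto(\omega y,z,\overline{\omega}x)_6$; $(x,y,z)_t\mapsto(\omega z,\overline{\omega}x,y)_t$ for $t=8,9$. Put $G=\langle a,b,c,d,e\rangle$. A bilinear product on $V$ is $G$-invariant if $[u^g,v^g]=[u,v]^g$ for all $u,v\in V$, $g\in G$. *)

theory Defs
  imports
    "HOL-Analysis.Cartesian_Space"
    "HOL-Algebra.Generated_Groups"
    "HOL-Computational_Algebra.Polynomial"
    "HOL-Computational_Algebra.Primes"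
begin

section \<open>The algebra $K = F[\omega]/(\omega^2+\omega+1)$\<close>

text \<open>\<open>mkK r s\<close> is the class of $r + s\omega$; the lemmas \<open>polyK_eq_0_iff\<close> and
  \<open>polyK_surj\<close> below identify this ring with the quotient of the polynomial ring.\<close>

datatype 'f K = mkK (coeff_1: 'f) (coeff_omega: 'f)

instantiation K :: (field) comm_ring_1
begin

definition "0 = mkK 0 0"
definition "1 = mkK 1 0"
definition "x + y = mkK (coeff_1 x + coeff_1 y) (coeff_omega x + coeff_omega y)"
definition "- x = mkK (- coeff_1 x) (- coeff_omega x)"
definition "x - y = mkK (coeff_1 x - coeff_1 y) (coeff_omega x - coeff_omega y)"
definition "x * y =
  mkK (coeff_1 x * coeff_1 y - coeff_omega x * coeff_omega y)
      (coeff_1 x * coeff_omega y + coeff_omega x * coeff_1 y - coeff_omega x * coeff_omega y)"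

instance
  by standard
     (auto simp: zero_K_def one_K_def plus_K_def uminus_K_def minus_K_def times_K_def
        algebra_simps)

end

definition of_base :: "'f::field \<Rightarrow> 'f K"
  where "of_base r = mkK r 0"

definition omega :: "'f::field K"  (\<open>\<omega>\<close>)
  where "\<omega> = mkK 0 1"

definition conjK :: "'f::field K \<Rightarrow> 'f K"
  where "conjK x = of_base (coeff_1 x) + of_base (coeff_omega x) * \<omega>\<^sup>2"

abbreviation omega_bar :: "'f::field K"  (\<open>\<omega>'_bar\<close>)
  where "\<omega>_bar \<equiv> conjK \<omega>"

definition theta :: "'f::field K"  (\<open>\<theta>\<close>)
  where "\<theta> = \<omega> - \<omega>_bar"

lemmas K_defs = zero_K_def one_K_def plus_K_def uminus_K_def minus_K_def times_K_def
  of_base_def omega_def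

lemma omega_relation: "\<omega>\<^sup>2 + \<omega> + 1 = (0 :: 'f::field K)"
  by (simp add: K_defs power2_eq_square)

lemma K_decomp: "x = of_base (coeff_1 x) + of_base (coeff_omega x) * \<omega>"
  by (cases x) (simp add: K_defs)

lemma conjK_mkK: "conjK (mkK r s) = mkK (r - s) (- s)"
  by (simp add: conjK_def K_defs power2_eq_square)

lemma omega_bar_eq: "\<omega>_bar = (\<omega>\<^sup>2 :: 'f::field K)" "\<omega>_bar = (- 1 - \<omega> :: 'f::field K)"
  by (simp_all add: conjK_def K_defs power2_eq_square)

lemma conjK_hom:
  "conjK (x + y) = conjK x + conjK y" "conjK (x * y) = conjK x * conjK y"
  "conjK (of_base r) = of_base r" "conjK (conjK x) = x"
  by (cases x; cases y; simp add: conjK_mkK K_defs algebra_simps)+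

lemma theta_square: "\<theta>\<^sup>2 = (- 3 :: 'f::field K)"
proof -
  have "(3 :: 'f K) = 1 + 1 + 1" by simp
  moreover have "\<theta>\<^sup>2 = - (1 + 1 + 1 :: 'f K)"
    unfolding theta_def power2_eq_square K_defs conjK_mkK by simp
  ultimately show ?thesis by simp
qed

lemma of_base_hom:
  "of_base 0 = 0" "of_base 1 = 1" "of_base (r + s) = of_base r + of_base s"
  "of_base (r * s) = of_base r * of_base s" "of_base (- r) = - of_base r"
  "of_base (r - s) = of_base r - of_base s"
  by (simp_all add: K_defs)

definition polyK :: "'f::field poly \<Rightarrow> 'f K"
  where "polyK q = poly (map_poly of_base q) \<omega>"

lemma polyK_pCons: "polyK (pCons r q) = of_base r + \<omega> * polyK q"
  unfolding polyK_def by (simp add: map_poly_pCons of_base_hom)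

lemma polyK_0 [simp]: "polyK 0 = 0"
  by (simp add: polyK_def)

lemma polyK_add: "polyK (q + q') = polyK q + polyK q'"
proof (induction q arbitrary: q')
  case (pCons r q)
  obtain r' q'' where "q' = pCons r' q''" by (cases q') auto
  then show ?case
    using pCons.IH[of q''] by (simp add: polyK_pCons of_base_hom algebra_simps)
qed simp

lemma polyK_smult: "polyK (smult r q) = of_base r * polyK q"
  by (induction q) (simp_all add: polyK_pCons of_base_hom algebra_simps)

lemma polyK_mult: "polyK (q * q') = polyK q * polyK q'"
  by (induction q) (simp_all add: polyK_pCons polyK_add polyK_smult of_base_hom algebra_simps)

lemma polyK_surj: "surj (polyK :: 'f::field poly \<Rightarrow> 'f K)"
proof (rule surjI)
  fix x :: "'f K"
  show "polyK [:coeff_1 x, coeff_omega x:] = x"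
    by (subst (3) K_decomp) (simp add: polyK_pCons mult.commute)
qed

lemma polyK_eq_0_iff: "polyK q = 0 \<longleftrightarrow> [:1, 1, 1:] dvd (q :: 'f::field poly)"
proof -
  let ?m = "[:1, 1, 1:] :: 'f poly"
  have m0: "polyK ?m = 0"
    by (simp add: polyK_pCons K_defs)
  define r where "r = q mod ?m"
  have "r = 0 \<or> degree r < 2"
    using degree_mod_less[of ?m q] by (auto simp: r_def)
  then have "degree r < 2" by auto
  then have r: "r = [:coeff r 0, coeff r 1:]"
    by (intro poly_eqI) (auto simp: coeff_pCons coeff_eq_0 split: nat.split)
  have "polyK q = polyK (?m * (q div ?m) + r)"
    by (simp add: r_def del: mult_pCons_left)
  also have "\<dots> = polyK r"
    by (simp only: polyK_add polyK_mult m0) simp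
  also have "\<dots> = mkK (coeff r 0) (coeff r 1)"
    by (subst r) (simp add: polyK_pCons K_defs)
  finally have "polyK q = 0 \<longleftrightarrow> coeff r 0 = 0 \<and> coeff r 1 = 0"
    by (simp add: zero_K_def)
  also have "\<dots> \<longleftrightarrow> r = 0"
    by (metis r pCons_0_0 coeff_0)
  also have "\<dots> \<longleftrightarrow> ?m dvd q"
    by (simp add: r_def dvd_eq_mod_eq_0)
  finally show ?thesis .
qed


section \<open>The space $V$\<close>

text \<open>Subscripts live in the type \<^typ>\<open>13\<close>, whose arithmetic is modulo 13;
  \<open>axis t v\<close> is the vector $v_t$.\<close>

type_synonym 'f V = "(('f K)^3)^13"

definition scaleV :: "'f::field \<Rightarrow> 'f V \<Rightarrow> 'f V"
  where "scaleV r v = (\<chi> t. of_base r *s v $ t)"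

abbreviation F_linear :: "('f::field V \<Rightarrow> 'f V) \<Rightarrow> bool"
  where "F_linear \<equiv> Vector_Spaces.linear scaleV scaleV"

abbreviation row3 :: "'f::field K \<Rightarrow> 'f K \<Rightarrow> 'f K \<Rightarrow> 'f K^3"
  where "row3 x y z \<equiv> vector [x, y, z]"

abbreviation mat3 :: "'f::field K^3 \<Rightarrow> 'f K^3 \<Rightarrow> 'f K^3 \<Rightarrow> 'f K^3^3"
  where "mat3 r1 r2 r3 \<equiv> vector [r1, r2, r3]"

text \<open>\<open>from_summands f\<close> is the map on the direct sum that sends $v_t$ to \<open>f t v\<close>.\<close>

definition from_summands :: "(13 \<Rightarrow> 'f::field K^3 \<Rightarrow> 'f V) \<Rightarrow> 'f V \<Rightarrow> 'f V"
  where "from_summands f v = (\<Sum>t\<in>UNIV. f t (v $ t))"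


section \<open>The generators\<close>

definition gen_a :: "'f::field V \<Rightarrow> 'f V"
  where "gen_a = from_summands (\<lambda>t v. axis (t + 1) v)"

definition gen_b :: "'f::field V \<Rightarrow> 'f V"
  where "gen_b = from_summands (\<lambda>t v.
    axis (3 * t) (row3 (\<omega> * v$1) (\<omega>_bar * v$2) (\<omega>_bar * v$3)))"

definition theta_third :: "'f::field K^3^3 \<Rightarrow> 'f K^3^3"
  where "theta_third A = (\<chi> i j. \<theta> * of_base (1 / 3) * A $ i $ j)"

definition M1 :: "'f::field K^3^3"
  where "M1 = theta_third (mat3
    (row3 \<omega> 1 1)
    (row3 1 \<omega> 1)
    (row3 1 1 \<omega>))"

definition M2 :: "'f::field K^3^3"
  where "M2 = theta_third (mat3
    (row3 1 1 1)
    (row3 1 \<omega>_bar \<omega>)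
    (row3 1 \<omega> \<omega>_bar))"

definition M3 :: "'f::field K^3^3"
  where "M3 = theta_third (mat3
    (row3 \<omega> \<omega> \<omega>)
    (row3 \<omega>_bar \<omega> 1)
    (row3 \<omega>_bar 1 \<omega>))"

definition M4 :: "'f::field K^3^3"
  where "M4 = theta_third (mat3
    (row3 1 \<omega> \<omega>)
    (row3 \<omega>_bar \<omega>_bar \<omega>)
    (row3 \<omega>_bar \<omega> \<omega>_bar))"

definition gen_c :: "'f::field V \<Rightarrow> 'f V"
  where "gen_c = from_summands (\<lambda>t v.
    let x = v$1; y = v$2; z = v$3; v' = row3 (conjK x) (conjK y) (conjK z) in
    if t = 0 then axis 0 (- row3 (conjK x) (conjK z) (conjK y))
    else if t = 1 then axis 1 (- row3 x z y)
    else if t = 3 then axis 9 (- row3 (\<omega> * x) (\<omega>_bar * z) (\<omega>_bar * y))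
    else if t = 9 then axis 3 (- row3 (\<omega>_bar * x) (\<omega> * z) (\<omega> * y))
    else if t = 4 then axis 10 v'
    else if t = 10 then axis 4 v'
    else if t = 12 then axis 12 v'
    else if t = 2 then axis 2 (v' v* M1)
    else if t = 8 then axis 8 (v' v* M2)
    else if t = 5 then axis 6 (v' v* M3)
    else if t = 6 then axis 5 (v' v* transpose M3)
    else if t = 7 then axis 11 (v' v* M4)
    else axis 7 (v' v* transpose M4))"

definition delta :: "13 \<Rightarrow> 'f::field K"
  where "delta t =
    (if t \<in> {0, 2, 8, 12} then 1 else if t \<in> {1, 3, 4, 5, 9, 11} then \<omega> else \<omega>_bar)"

definition gen_d :: "'f::field V \<Rightarrow> 'f V"
  where "gen_d = from_summands (\<lambda>t v. axis t (delta t *s v))"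

definition gen_e :: "'f::field V \<Rightarrow> 'f V"
  where "gen_e = from_summands (\<lambda>t v.
    let x = v$1; y = v$2; z = v$3 in
    axis t
     (if t = 0 then row3 x y z
      else if t \<in> {1, 11} then row3 z x y
      else if t = 2 then row3 (\<omega>_bar * y) z (\<omega> * x)
      else if t \<in> {3, 7} then row3 (\<omega>_bar * z) (\<omega> * x) y
      else if t \<in> {4, 10, 12} then row3 x (\<omega> * y) (\<omega>_bar * z)
      else if t = 5 then row3 y z x
      else if t = 6 then row3 (\<omega> * y) z (\<omega>_bar * x)
      else row3 (\<omega> * z) (\<omega>_bar * x) y))"


section \<open>The group and invariant products\<close>

text \<open>Group elements act on the right, so the product of \<open>g\<close> and \<open>h\<close> applies \<open>g\<close> first.\<close>

definition GL_V :: "('f::field V \<Rightarrow> 'f V) monoid"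
  where "GL_V = \<lparr>carrier = {g. F_linear g \<and> bij g}, monoid.mult = (\<lambda>g h. h \<circ> g), one = id\<rparr>"

definition G :: "('f::field V \<Rightarrow> 'f V) set"
  where "G = generate GL_V {gen_a, gen_b, gen_c, gen_d, gen_e}"

definition F_bilinear :: "('f::field V \<Rightarrow> 'f V \<Rightarrow> 'f V) \<Rightarrow> bool"
  where "F_bilinear B \<longleftrightarrow> (\<forall>u. F_linear (\<lambda>v. B u v)) \<and> (\<forall>v. F_linear (\<lambda>u. B u v))"

definition G_invariant :: "('f::field V \<Rightarrow> 'f V \<Rightarrow> 'f V) \<Rightarrow> bool"
  where "G_invariant B \<longleftrightarrow> (\<forall>g\<in>G. \<forall>u v. B (g u) (g v) = g (B u v))"

lemma vector_space_scaleV: "vector_space (scaleV :: 'f::field \<Rightarrow> 'f V \<Rightarrow> 'f V)"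
  by unfold_locales
     (simp_all add: scaleV_def vec_eq_iff of_base_hom algebra_simps)

lemma F_linearI:
  assumes "\<And>u v. g (u + v) = g u + g v" "\<And>r v. g (scaleV r v) = scaleV r (g v)"
  shows "F_linear g"
  using assms vector_space_scaleV
  by (simp add: Vector_Spaces.linear_def module_hom_def module_hom_axioms_def
      vector_space_def module_def)

lemma group_GL_V: "group (GL_V :: ('f::field V \<Rightarrow> 'f V) monoid)"
proof (rule groupI)
  show "\<exists>h\<in>carrier GL_V. h \<otimes>\<^bsub>GL_V\<^esub> g = \<one>\<^bsub>GL_V\<^esub>"
    if "g \<in> carrier GL_V" for g :: "'f V \<Rightarrow> 'f V"
  proof -
    have g: "F_linear g" "bij g" using that by (auto simp: GL_V_def)
    interpret Vector_Spaces.linear scaleV scaleV g by (rule g(1))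
    have inj: "inj g" and surj: "surj g" using g(2) by (auto simp: bij_def)
    have "F_linear (inv_into UNIV g)"
    proof (rule F_linearI)
      show "inv_into UNIV g (u + v) = inv_into UNIV g u + inv_into UNIV g v" for u v
        by (metis add inj inv_f_f surj surj_f_inv_f)
      show "inv_into UNIV g (scaleV r v) = scaleV r (inv_into UNIV g v)" for r v
        by (metis scale inj inv_f_f surj surj_f_inv_f)
    qed
    then show ?thesis
      using g(2) surj by (intro bexI[of _ "inv_into UNIV g"])
        (auto simp: GL_V_def bij_imp_bij_inv fun_eq_iff surj_f_inv_f)
  qed
  show "\<one>\<^bsub>GL_V\<^esub> \<in> carrier (GL_V :: ('f V \<Rightarrow> 'f V) monoid)"
    by (auto simp: GL_V_def intro: F_linearI)
  show "g \<otimes>\<^bsub>GL_V\<^esub> h \<in> carrier GL_V"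
    if "g \<in> carrier GL_V" "h \<in> carrier GL_V" for g h :: "'f V \<Rightarrow> 'f V"
    using that Vector_Spaces.linear_compose[of scaleV scaleV g scaleV h]
    by (simp add: GL_V_def bij_comp)
qed (simp_all add: GL_V_def comp_assoc)


section \<open>The generators are automorphisms\<close>

lemma forall_13: "(\<forall>t::13. P t) \<longleftrightarrow> P 0 \<and> P 1 \<and> P 2 \<and> P 3 \<and> P 4 \<and> P 5 \<and> P 6 \<and> P 7 \<and>
    P 8 \<and> P 9 \<and> P 10 \<and> P 11 \<and> P 12"
proof -
  have "\<exists>n<13. t = of_nat n" for t :: 13
  proof -
    obtain z :: int where z: "t = of_int z" "0 \<le> z" "z < int CARD(13)"
      by (rule bit1_cases[of t]) auto
    then have "t = of_nat (nat z)" "nat z < 13" by auto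
    then show ?thesis by blast
  qed
  then have "t \<in> of_nat ` {..<13}" for t :: 13
    by blast
  moreover have "{..<13::nat} = {0, 1, 2, 3, 4, 5, 6, 7, 8, 9, 10, 11, 12}"
    by (simp add: lessThan_nat_numeral lessThan_Suc insert_commute)
  ultimately have t: "t \<in> {0, 1, 2, 3, 4, 5, 6, 7, 8, 9, 10, 11, 12}" for t :: 13
    by simp
  have "P t" if "P 0 \<and> P 1 \<and> P 2 \<and> P 3 \<and> P 4 \<and> P 5 \<and> P 6 \<and> P 7 \<and>
    P 8 \<and> P 9 \<and> P 10 \<and> P 11 \<and> P 12" for t
    using t[of t] that by (elim insertE) (simp_all only: empty_iff)
  then show ?thesis by blast
qed

lemma UNIV_13: "(UNIV :: 13 set) = {0, 1, 2, 3, 4, 5, 6, 7, 8, 9, 10, 11, 12}"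
  by (simp add: set_eq_iff forall_13)

lemma from_summands_axis:
  assumes "\<And>t. \<sigma> (\<pi> t) = t" "\<And>s. \<pi> (\<sigma> s) = s"
  shows "from_summands (\<lambda>t v. axis (\<pi> t) (A t v)) v $ s = A (\<sigma> s) (v $ \<sigma> s)"
proof -
  have "from_summands (\<lambda>t v. axis (\<pi> t) (A t v)) v $ s =
      (\<Sum>t\<in>UNIV. if t = \<sigma> s then A t (v $ t) else 0)"
    unfolding from_summands_def axis_def sum_component vec_lambda_beta
    by (rule sum.cong) (use assms in auto)
  then show ?thesis by simp
qed

lemma from_summands_13:
  "from_summands f v = f 0 (v $ 0) + f 1 (v $ 1) + f 2 (v $ 2) + f 3 (v $ 3) + f 4 (v $ 4) +
    f 5 (v $ 5) + f 6 (v $ 6) + f 7 (v $ 7) + f 8 (v $ 8) + f 9 (v $ 9) + f 10 (v $ 10) +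
    f 11 (v $ 11) + f 12 (v $ 12)"
  unfolding from_summands_def UNIV_13 by (simp add: add.assoc)

lemma bij_involution: "(\<And>x. g (g x) = x) \<Longrightarrow> bij g"
  by (rule o_bij[of g]) auto

lemma bij_order_3: "(\<And>x. g (g (g x)) = x) \<Longrightarrow> bij g"
  by (rule o_bij[of "g \<circ> g"]) auto

lemma three_neq_0:
  assumes "prime p" "p \<noteq> 3" "CHAR('f::field) = p"
  shows "(3 :: 'f) \<noteq> 0"
proof
  assume "(3 :: 'f) = 0"
  then have "of_nat 3 = (0 :: 'f)" by simp
  then have "p dvd 3" using assms(3) of_nat_eq_0_iff_char_dvd by blast
  then show False using assms(1,2) primes_dvd_imp_eq[of p 3] by simp
qed

lemma comp_eqs:
  "mkK 0 0 = 0" "mkK 1 0 = 1"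
  "mkK r s + mkK r' s' = mkK (r + r') (s + s')"
  "mkK r s - mkK r' s' = mkK (r - r') (s - s')"
  "- mkK r s = mkK (- r) (- s)"
  "mkK r s * mkK r' s' = mkK (r * r' - s * s') (r * s' + s * r' - s * s')"
  by (simp_all add: K_defs)

lemma conjK_minus: "conjK (- x) = - conjK x"
  by (cases x) (simp add: conjK_mkK comp_eqs)

lemma omega_cancel:
  "\<omega> * (\<omega>_bar * x) = x" "\<omega>_bar * (\<omega> * x) = x"
  "\<omega> * (\<omega> * x) = \<omega>_bar * x" "\<omega>_bar * (\<omega>_bar * x) = \<omega> * x"
  by (simp_all flip: mult.assoc, simp_all add: conjK_mkK omega_def comp_eqs)

lemma thirteen_simps: "(13 :: 13) = 0" "(27 :: 13) = 1" "(729 :: 13) = 1"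
  by (simp_all add: bit1.iszero_numeral[unfolded iszero_def])

lemma gen_a_component: "gen_a v $ s = v $ (s - 1)"
  unfolding gen_a_def by (rule from_summands_axis) simp_all

lemma gen_b_component:
  "gen_b v $ s = row3 (\<omega> * v$(9 * s)$1) (\<omega>_bar * v$(9 * s)$2) (\<omega>_bar * v$(9 * s)$3)"
  unfolding gen_b_def
  by (rule from_summands_axis) (simp_all add: thirteen_simps flip: mult.assoc)

lemma gen_d_component: "gen_d v $ s = delta s *s v $ s"
  unfolding gen_d_def by (rule from_summands_axis) simp_all

definition block_e :: "13 \<Rightarrow> 'f::field K^3 \<Rightarrow> 'f K^3"
  where "block_e t v =
    (let x = v$1; y = v$2; z = v$3 in
      if t = 0 then row3 x y z
      else if t \<in> {1, 11} then row3 z x y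
      else if t = 2 then row3 (\<omega>_bar * y) z (\<omega> * x)
      else if t \<in> {3, 7} then row3 (\<omega>_bar * z) (\<omega> * x) y
      else if t \<in> {4, 10, 12} then row3 x (\<omega> * y) (\<omega>_bar * z)
      else if t = 5 then row3 y z x
      else if t = 6 then row3 (\<omega> * y) z (\<omega>_bar * x)
      else row3 (\<omega> * z) (\<omega>_bar * x) y)"

lemma gen_e_component: "gen_e v $ s = block_e s (v $ s)"
proof -
  have "gen_e = from_summands (\<lambda>t v. axis t (block_e t v))"
    unfolding gen_e_def block_e_def Let_def ..
  then have "gen_e v $ s = from_summands (\<lambda>t v. axis t (block_e t v)) v $ s"
    by (rule arg_cong)
  also have "\<dots> = block_e s (v $ s)"
    by (rule from_summands_axis) simp_all
  finally show ?thesis .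
qed

lemma block_e_eqs:
  "\<forall>t. \<forall>u v. block_e t (u + v) = block_e t u + block_e t v"
  "\<forall>t. \<forall>r v. block_e t (r *s v) = r *s block_e t v"
  "\<forall>t. \<forall>v. block_e t (block_e t (block_e t v)) = v"
  unfolding forall_13
  by (simp_all add: block_e_def Let_def vec_eq_iff forall_3 distrib_left mult.left_commute
      omega_cancel)

lemma delta_cube: "delta s * (delta s * (delta s * x)) = x"
  by (simp add: delta_def omega_cancel)

definition conjv :: "'f::field K^'n \<Rightarrow> 'f K^'n"
  where "conjv v = (\<chi> i. conjK (v $ i))"

lemma row3_conjK: "row3 (conjK (v$1)) (conjK (v$2)) (conjK (v$3)) = conjv v"
  by (simp add: conjv_def vec_eq_iff forall_3)

lemma conjv_conjv: "conjv (conjv v) = v"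
  by (simp add: conjv_def vec_eq_iff conjK_hom)

definition conjM :: "'f::field K^3^3 \<Rightarrow> 'f K^3^3"
  where "conjM A = (\<chi> i. conjv (A $ i))"

lemma conjv_vM: "conjv (v v* A) = conjv v v* conjM A"
  by (simp add: conjv_def conjM_def vector_matrix_mult_def vec_eq_iff sum_3 conjK_hom)

lemma gen_c_eq:
  "gen_c v = (\<chi> t.
     if t = 0 then - row3 (conjK (v$0$1)) (conjK (v$0$3)) (conjK (v$0$2))
     else if t = 1 then - row3 (v$1$1) (v$1$3) (v$1$2)
     else if t = 3 then - row3 (\<omega>_bar * v$9$1) (\<omega> * v$9$3) (\<omega> * v$9$2)
     else if t = 9 then - row3 (\<omega> * v$3$1) (\<omega>_bar * v$3$3) (\<omega>_bar * v$3$2)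
     else if t = 4 then conjv (v$10) else if t = 10 then conjv (v$4)
     else if t = 12 then conjv (v$12)
     else if t = 2 then conjv (v$2) v* M1 else if t = 8 then conjv (v$8) v* M2
     else if t = 5 then conjv (v$6) v* transpose M3 else if t = 6 then conjv (v$5) v* M3
     else if t = 7 then conjv (v$11) v* transpose M4 else conjv (v$7) v* M4)"
  unfolding gen_c_def Let_def row3_conjK
  by (simp add: from_summands_13 vec_eq_iff axis_def forall_13)

lemma lin_a: "F_linear gen_a"
  by (rule F_linearI) (simp_all add: vec_eq_iff gen_a_component scaleV_def)

lemma lin_b: "F_linear gen_b"
  by (rule F_linearI)
     (simp_all add: vec_eq_iff forall_3 gen_b_component scaleV_def distrib_left mult.left_commute)

lemma conjv_linear:
  "conjv (u + v) = conjv u + conjv v" "conjv (of_base r *s v) = of_base r *s conjv v"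
  by (simp_all add: conjv_def vec_eq_iff conjK_hom)

lemma vM_linear: "(u + v) v* A = u v* A + v v* A" "(r *s v) v* A = r *s (v v* A)"
  for r :: "'a::comm_ring_1"
  by (simp_all add: vector_matrix_mult_def vec_eq_iff distrib_right sum.distrib
      sum_distrib_left mult.assoc)

lemma lin_c: "F_linear gen_c"
proof (rule F_linearI)
  show "gen_c (u + v) = gen_c u + gen_c v" for u v :: "'a V"
    unfolding vec_eq_iff[of "gen_c (u + v)"] forall_13
    by (simp add: gen_c_eq conjv_linear vM_linear del: vector_transpose_matrix)
       (simp add: vec_eq_iff forall_3 conjK_hom distrib_left)
  show "gen_c (scaleV r v) = scaleV r (gen_c v)" for r and v :: "'a V"
    unfolding vec_eq_iff[of "gen_c (scaleV r v)"] forall_13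
    by (simp add: gen_c_eq scaleV_def conjv_linear vM_linear del: vector_transpose_matrix)
       (simp add: vec_eq_iff forall_3 conjK_hom mult.left_commute)
qed

lemma lin_d: "F_linear gen_d"
  by (rule F_linearI)
     (simp_all add: vec_eq_iff gen_d_component scaleV_def distrib_left mult.left_commute)

lemma lin_e: "F_linear gen_e"
  by (rule F_linearI) (simp_all add: vec_eq_iff[where 'b = 13] gen_e_component scaleV_def block_e_eqs)

lemma bij_a: "bij gen_a"
  by (rule o_bij[of "\<lambda>v. \<chi> t. v $ (t + 1)"])
     (simp_all add: fun_eq_iff vec_eq_iff gen_a_component)

lemma bij_b: "bij gen_b"
proof (rule bij_order_3)
  fix v :: "'a V"
  have s: "9 * (9 * (9 * s)) = s" for s :: 13
    by (simp add: thirteen_simps flip: mult.assoc)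
  show "gen_b (gen_b (gen_b v)) = v"
    unfolding vec_eq_iff[of _ v] vec_eq_iff[of _ "v $ _"] forall_3 gen_b_component
    by (simp only: vector_3 omega_cancel s simp_thms)
qed

lemma bij_d: "bij gen_d"
  by (rule bij_order_3) (simp add: vec_eq_iff gen_d_component delta_cube)

lemma bij_e: "bij gen_e"
  by (rule bij_order_3) (simp add: vec_eq_iff[where 'b = 13] gen_e_component block_e_eqs)

lemma numeral_K: "numeral n = (mkK (numeral n) 0 :: 'f::field K)"
  by (induction n) (simp_all only: numeral.simps plus_K_def one_K_def K.sel add_0)

lemma theta_third_mult:
  assumes "(3 :: 'f::field) \<noteq> 0" "conjM A ** B = (\<chi> i j. if i = j then 3 else 0)"
  shows "conjM (theta_third A) ** theta_third B = (mat 1 :: 'f K^3^3)"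
proof -
  let ?h = "1 / 3 :: 'f"
  have t: "conjK \<theta> * \<theta> = (of_base 3 :: 'f K)"
    by (simp add: theta_def omega_def conjK_mkK comp_eqs of_base_def)
  have h: "?h * ?h * 3 = ?h"
  proof -
    have "?h * 3 = 1" using assms(1) by simp
    then show ?thesis by (simp only: mult.assoc mult_1_right)
  qed
  have "conjK (\<theta> * of_base ?h) * (\<theta> * of_base ?h) =
      of_base ?h * of_base ?h * (conjK \<theta> * \<theta>)"
    by (simp only: conjK_hom mult.assoc mult.commute mult.left_commute)
  also have "\<dots> = of_base (?h * ?h * 3)"
    by (simp only: t of_base_hom(4))
  finally have s: "conjK (\<theta> * of_base ?h) * (\<theta> * of_base ?h) = of_base ?h"
    unfolding h .
  have "(conjM (theta_third A) ** theta_third B) $ i $ j =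
      of_base (1 / 3) * (conjM A ** B) $ i $ j" for i j
  proof -
    have "(conjM (theta_third A) ** theta_third B) $ i $ j =
      (\<Sum>k\<in>UNIV. conjK (\<theta> * of_base (1 / 3)) * (\<theta> * of_base (1 / 3)) *
         (conjK (A $ i $ k) * B $ k $ j))"
      unfolding matrix_matrix_mult_def conjM_def conjv_def theta_third_def
      by (simp add: conjK_hom(2) mult.assoc mult.left_commute)
    then show ?thesis
      unfolding s by (simp add: matrix_matrix_mult_def conjM_def conjv_def sum_distrib_left)
  qed
  then show ?thesis
    using assms by (simp add: vec_eq_iff mat_def of_base_def numeral_K comp_eqs)
qed

lemma transpose_theta_third: "transpose (theta_third A) = theta_third (transpose A)"
  by (simp add: transpose_def theta_third_def)

lemma conjK_01: "conjK 1 = 1"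
  by (simp add: conjK_mkK one_K_def)

lemma M_inv:
  assumes "(3 :: 'f::field) \<noteq> 0"
  shows "conjM M1 ** M1 = (mat 1 :: 'f K^3^3)" "conjM M2 ** M2 = (mat 1 :: 'f K^3^3)"
    "conjM M3 ** transpose M3 = (mat 1 :: 'f K^3^3)"
    "conjM (transpose M3) ** M3 = (mat 1 :: 'f K^3^3)"
    "conjM M4 ** transpose M4 = (mat 1 :: 'f K^3^3)"
    "conjM (transpose M4) ** M4 = (mat 1 :: 'f K^3^3)"
  unfolding M1_def M2_def M3_def M4_def transpose_theta_third
  by (rule theta_third_mult[OF assms],
      simp add: conjM_def conjv_def matrix_matrix_mult_def transpose_def vec_eq_iff
        forall_3 sum_3 conjK_hom(4) conjK_01,
      simp add: omega_def conjK_mkK numeral_K K_defs)+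

lemma bij_c:
  assumes "(3 :: 'f::field) \<noteq> 0"
  shows "bij (gen_c :: 'f V \<Rightarrow> 'f V)"
proof (rule bij_involution)
  fix v :: "'f V"
  show "gen_c (gen_c v) = v"
    unfolding vec_eq_iff[of "gen_c (gen_c v)"] forall_13
    unfolding gen_c_eq[of "gen_c v"]
    by (simp add: gen_c_eq[of v] conjv_vM vector_matrix_mul_assoc M_inv[OF assms] conjv_conjv
         del: vector_transpose_matrix)
       (simp add: vec_eq_iff forall_3 conjK_minus conjK_hom omega_cancel)
qed

lemma generators_in_GL_V:
  assumes "prime p" "p \<noteq> 3" "CHAR('f::field) = p"
  shows "{gen_a, gen_b, gen_c, gen_d, gen_e} \<subseteq> carrier (GL_V :: ('f V \<Rightarrow> 'f V) monoid)"
  using bij_c[OF three_neq_0[OF assms]]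
  by (simp add: GL_V_def lin_a lin_b lin_c lin_d lin_e bij_a bij_b bij_d bij_e)

end

theory Submission
  imports Defs
begin

text \<open>
  The conjugates of $d$ under the powers of $a$ generate a group of order $27$ that acts on $V_t$ by
  scalars $\omega^{f_t}$, where $\pm f_0, \dots, \pm f_{12}$ are the $26$ nonzero characters of that
  group. So the subscripts are the points of the projective plane of order $3$, the lines are the
  translates of $\{0,1,3,9\}$, and invariance under these diagonal maps forces $[V_t, V_s]$, for
  $t \neq s$, into the two remaining summands on the line through $t$ and $s$; each of the two
  components is additive and $K$-linear up to conjugation in each argument.

  Existence. Number the standard basis $e_1, e_2, e_3$ of $K^3$ by $0, 1, 2$ in $\mathbb{F}_3$. Then the
  coefficient of basis vector $k$ in a component of the product of basis vector $i$ of $V_t$ and basis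
  vector $j$ of $V_s$ is $\pm\omega^{q(i,j,k)}$ for a
  quadratic polynomial $q$ over $\mathbb{F}_3$ that depends only on $s - t$ and on the component.
  A table of these $24$ polynomials defines \<open>product\<close>. Its antisymmetry and its invariance under the
  generators need to be seen only on $K$-multiples of coordinate vectors, with the scalars as
  variables. All coefficients that occur there are, after $c$ has been multiplied by $3$, of the form
  $\pm\theta^a\omega^e$, so each claim is an identity in $\mathbb{Z}[\omega]$, which holds in $K$
  over every field. These identities are checked by computation
  (\<open>check_antisym\<close>, \<open>check_a\<close>, \dots, \<open>check_e\<close>).

  Transitivity. A relation on $V$ that is additive and $\mathbb{F}$-homogeneous in each argument and
  is preserved by the generators holds on all $V_t \times V_s$ with $t \neq s$ as soon as it relates
  $(e_1)_0$ to $(e_1)_1$ (\<open>two_transitive\<close>). Applied to the relation that the Jacobi expression of $x$,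
  $y$ and every $z$ vanishes, it reduces the Jacobi identity to the computation with
  $x = (e_1)_0$ and $y = (e_1)_1$ (\<open>check_jacobi\<close>, \<open>jacobi\<close>).

  Uniqueness. Applied to the relation $[x, y] = 0$, it shows that the products $[V_t, V_s]$ with
  $t \neq s$ all vanish if $[(e_1)_0, (e_1)_1]$ does. The products $[V_t, V_t]$ vanish
  for every invariant product (\<open>diagonal_zero\<close>, where $2 \neq 0$ enters), so an invariant product is
  determined by $[(e_1)_0, (e_1)_1]$. Finally the elements of $G$ that fix, or almost fix, this pair
  of vectors leave only one free parameter from $\mathbb{F}$ in that value (\<open>base_value_shape\<close>).
\<close>

section \<open>Coordinates and cube roots of unity\<close>

text \<open>$\mathbb{F}_3$ supplies both the exponents of \<open>\<omega>\<close> and, through \<open>ix\<close>, the numbering of the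
  coordinates of $K^3$: the exponents in the structure constants are polynomials in the coordinate
  numbers. A datatype lets the simplifier evaluate such exponents by pattern matching.\<close>

datatype f3 = F0 | F1 | F2

fun f3_neg :: "f3 \<Rightarrow> f3" where
  "f3_neg F0 = F0" | "f3_neg F1 = F2" | "f3_neg F2 = F1"

fun f3_add :: "f3 \<Rightarrow> f3 \<Rightarrow> f3" where
  "f3_add F0 x = x"
| "f3_add F1 F0 = F1" | "f3_add F1 F1 = F2" | "f3_add F1 F2 = F0"
| "f3_add F2 F0 = F2" | "f3_add F2 F1 = F0" | "f3_add F2 F2 = F1"

fun f3_mult :: "f3 \<Rightarrow> f3 \<Rightarrow> f3" where
  "f3_mult F0 x = F0" | "f3_mult F1 x = x" | "f3_mult F2 x = f3_neg x"

fun ix :: "f3 \<Rightarrow> 3" where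
  "ix F0 = 1" | "ix F1 = 2" | "ix F2 = 3"

fun zeta :: "f3 \<Rightarrow> 'f::field K" where
  "zeta F0 = 1" | "zeta F1 = \<omega>" | "zeta F2 = \<omega>_bar"

fun conj_if :: "bool \<Rightarrow> 'f::field K \<Rightarrow> 'f K" where
  "conj_if True x = conjK x" | "conj_if False x = x"

lemma conjK_0: "conjK 0 = 0"
  by (simp add: conjK_mkK zero_K_def)

lemma conj_if_hom:
  "conj_if c (x + y) = conj_if c x + conj_if c y" "conj_if c (x * y) = conj_if c x * conj_if c y"
  "conj_if c 0 = 0" "conj_if c 1 = 1" "conj_if c (- x) = - conj_if c x"
  by (cases c; simp add: conjK_hom conjK_01 conjK_minus conjK_0)+

lemma zeta_add: "zeta (f3_add e e') = zeta e * zeta e'"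
  by (cases e; cases e') (simp_all add: conjK_mkK omega_def comp_eqs)

lemma zeta_neg: "zeta (f3_neg e) = conjK (zeta e)"
  by (cases e) (simp_all add: conjK_hom conjK_01)

lemma UNIV_f3: "(UNIV :: f3 set) = {F0, F1, F2}"
  using f3.exhaust by auto

instance f3 :: finite
  by standard (simp add: UNIV_f3)

lemma ix_eq_iff: "ix i = ix j \<longleftrightarrow> i = j"
  by (cases i; cases j) simp_all

lemma ex_ix: "\<exists>i. k = ix i"
  by (metis exhaust_3 ix.simps)

lemma ex_point: "\<exists>n<13. t = (of_nat n :: 13)"
proof -
  obtain z :: int where z: "t = of_int z" "0 \<le> z" "z < int CARD(13)"
    by (rule bit1_cases[of t]) auto
  then have "t = of_nat (nat z)" "nat z < 13" by auto
  then show ?thesis by blast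
qed

lemma inj_point: "inj_on (of_nat :: nat \<Rightarrow> 13) {..<13}"
proof (rule eq_card_imp_inj_on)
  have "(of_nat :: nat \<Rightarrow> 13) ` {..<13} = UNIV"
  proof (rule UNIV_eq_I[symmetric])
    fix t :: 13
    obtain n where "n < 13" "t = of_nat n" using ex_point[of t] by (elim exE conjE)
    then show "t \<in> of_nat ` {..<13}" by (intro image_eqI) (simp_all only: lessThan_iff)
  qed
  then show "card ((of_nat :: nat \<Rightarrow> 13) ` {..<13}) = card {..<13::nat}"
    by simp
qed simp

definition coord :: "nat \<Rightarrow> f3 \<Rightarrow> 'f::field K \<Rightarrow> 'f V" where
  "coord t i x = axis (of_nat t) (axis (ix i) x)"

lemma coord_add: "coord t i (x + y) = coord t i x + coord t i y"
  by (simp add: coord_def axis_def vec_eq_iff)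

lemma coord_0: "coord t i 0 = 0"
  by (simp add: coord_def axis_def vec_eq_iff)

lemma scaleV_coord: "scaleV r (coord t i x) = coord t i (of_base r * x)"
  by (simp add: coord_def axis_def vec_eq_iff scaleV_def)

lemma coord_component:
  "t < 13 \<Longrightarrow> s < 13 \<Longrightarrow> coord t i x $ of_nat s $ ix j = (if t = s \<and> i = j then x else 0)"
  using inj_point by (auto simp: coord_def axis_def ix_eq_iff inj_on_def)

lemma V_eqI:
  assumes "\<And>t i. t < 13 \<Longrightarrow> u $ of_nat t $ ix i = v $ of_nat t $ ix i"
  shows "u = (v :: 'f::field V)"
  unfolding vec_eq_iff
proof (intro allI)
  fix t :: 13 and k :: 3
  obtain n where n: "n < 13" and t: "t = of_nat n" using ex_point[of t] by (elim exE conjE)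
  obtain i where k: "k = ix i" using ex_ix[of k] by (elim exE)
  show "u $ t $ k = v $ t $ k"
    unfolding t k by (rule assms[OF n])
qed

lemma V_decomp: "v = (\<Sum>t<13. \<Sum>i\<in>UNIV. coord t i (v $ of_nat t $ ix i))"
proof (rule V_eqI)
  fix s :: nat and j
  assume s: "s < 13"
  have "(\<Sum>t<13. \<Sum>i\<in>UNIV. coord t i (v $ of_nat t $ ix i)) $ of_nat s $ ix j
      = (\<Sum>t<13. \<Sum>i\<in>UNIV. if t = s \<and> i = j then v $ of_nat t $ ix i else 0)"
    unfolding sum_component
    by (intro sum.cong refl coord_component s) (simp only: lessThan_iff)
  also have "\<dots> = (\<Sum>t<13. if t = s then v $ of_nat t $ ix j else 0)"
  proof (rule sum.cong[OF refl])
    show "(\<Sum>i\<in>UNIV. if t = s \<and> i = j then v $ of_nat t $ ix i else 0) =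
        (if t = s then v $ of_nat t $ ix j else 0)" for t
      by (cases "t = s") simp_all
  qed
  also have "\<dots> = v $ of_nat s $ ix j"
    using s by (simp only: sum.delta finite_lessThan lessThan_iff if_True)
  finally show "v $ of_nat s $ ix j =
      (\<Sum>t<13. \<Sum>i\<in>UNIV. coord t i (v $ of_nat t $ ix i)) $ of_nat s $ ix j"
    by (rule sym)
qed

text \<open>Coordinate vectors are taken with arbitrary entries in $K$, so that sums alone reach all of $V$.\<close>

lemma V_induct:
  assumes "\<And>u v. P u \<Longrightarrow> P v \<Longrightarrow> P (u + v)"
    and "\<And>t i x. t < 13 \<Longrightarrow> P (coord t i x)"
  shows "P v"
proof -
  have P0: "P 0" using assms(2)[of 0 _ 0] by (simp add: coord_0)
  have sum: "P (sum f A)" if "finite A" "\<And>a. a \<in> A \<Longrightarrow> P (f a)" for f and A :: "'b set"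
    using that by (induction A rule: finite_induct) (auto simp: P0 assms(1))
  show ?thesis
    by (subst V_decomp) (intro sum assms(2), auto)
qed


section \<open>Formal combinations of coordinate vectors\<close>

text \<open>\<open>Mon a n e\<close> denotes $(-1)^n\theta^a\omega^e$. This shape is closed under products and conjugation,
  and it contains three times every entry of the matrix of $c$, because $3 = -\theta^2$.\<close>

datatype mon = Mon nat bool f3

text \<open>\<open>Term t i f m\<close> is \<open>m\<close> times a product of scalar variables from $K$, placed in coordinate \<open>i\<close> of $V_t$;
  the list \<open>f\<close> tells which of the variables are conjugated. Since the maps in question are only
  semilinear over $K$, carrying the scalars along as variables is what allows a single formal
  computation to cover all multiples of a coordinate vector.\<close>

datatype formal_term = Term nat f3 "bool list" mon

fun mon_val :: "mon \<Rightarrow> 'f::field K" where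
  "mon_val (Mon a n e) = (if n then - 1 else 1) * \<theta> ^ a * zeta e"

fun vars :: "bool list \<Rightarrow> 'f::field K list \<Rightarrow> 'f K" where
  "vars (c # cs) (x # xs) = conj_if c x * vars cs xs"
| "vars _ _ = 1"

fun sem1 :: "'f::field K list \<Rightarrow> formal_term \<Rightarrow> 'f V" where
  "sem1 xs (Term t i f m) = coord t i (mon_val m * vars f xs)"

definition sem :: "'f::field K list \<Rightarrow> formal_term list \<Rightarrow> 'f V" where
  "sem xs L = sum_list (map (sem1 xs) L)"

lemma sem_simps [simp]:
  "sem xs [] = 0" "sem xs (m # L) = sem1 xs m + sem xs L" "sem xs (L @ L') = sem xs L + sem xs L'"
  by (simp_all add: sem_def)

fun xor :: "bool \<Rightarrow> bool \<Rightarrow> bool" where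
  "xor True b = (\<not> b)" | "xor False b = b"

fun odd_exp :: "nat \<Rightarrow> bool" where
  "odd_exp 0 = False" | "odd_exp (Suc n) = (\<not> odd_exp n)"

fun mon_mult :: "mon \<Rightarrow> mon \<Rightarrow> mon" where
  "mon_mult (Mon a n e) (Mon b m f) = Mon (a + b) (xor n m) (f3_add e f)"

fun mon_conj :: "bool \<Rightarrow> mon \<Rightarrow> mon" where
  "mon_conj True (Mon a n e) = Mon a (xor n (odd_exp a)) (f3_neg e)"
| "mon_conj False m = m"

fun flags_conj :: "bool \<Rightarrow> bool list \<Rightarrow> bool list" where
  "flags_conj True f = map Not f" | "flags_conj False f = f"

lemma mon_val_mult: "mon_val (mon_mult m m') = mon_val m * mon_val m'"
  by (cases m; cases m'; rename_tac a n e a' n' e'; case_tac n; case_tac n')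
     (simp_all add: zeta_add power_add mult_ac)

lemma conjK_theta: "conjK \<theta> = - \<theta>"
  by (simp add: theta_def omega_def conjK_mkK comp_eqs)

lemma conjK_theta_power: "conjK (\<theta> ^ a) = (if odd_exp a then - (\<theta> ^ a) else \<theta> ^ a)"
  by (induction a) (auto simp: conjK_01 conjK_hom conjK_theta)

lemma mon_val_conj: "mon_val (mon_conj c m) = conj_if c (mon_val m)"
proof (cases c)
  case True
  obtain a n e where m: "m = Mon a n e" by (cases m)
  show ?thesis
    by (cases n)
       (simp_all add: m True conjK_hom conjK_theta_power zeta_neg conjK_minus conjK_01)
qed simp

lemma vars_conj: "vars (flags_conj c f) xs = conj_if c (vars f xs)"
proof (cases c)
  case True
  have "vars (map Not f) xs = conjK (vars f xs)"
  proof (induction f xs rule: vars.induct)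
    case (1 b f x xs)
    then show ?case by (cases b) (simp_all add: conjK_hom)
  qed (simp_all add: conjK_01)
  then show ?thesis by (simp add: True)
qed simp

lemma length_flags_conj [simp]: "length (flags_conj c f) = length f"
  by (cases c) simp_all

lemma vars_append: "length f = length xs \<Longrightarrow> vars (f @ g) (xs @ ys) = vars f xs * vars g ys"
  by (induction f xs rule: list_induct2) (simp_all add: mult.assoc)

section \<open>Cancellation in the Eisenstein integers\<close>

text \<open>Cancellation of formal terms is tested in $\mathbb{Z}[\omega]$, whose elements are pairs of integers.
  The homomorphism \<open>eis\<close> to $K$ exists over every field, hence the outcome of the test is valid in
  every characteristic.\<close>

fun eis :: "int \<times> int \<Rightarrow> 'f::field K" where
  "eis (a, b) = mkK (of_int a) (of_int b)"

fun rotate :: "f3 \<Rightarrow> int \<Rightarrow> int \<Rightarrow> int \<times> int" where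
  "rotate F0 a b = (a, b)"
| "rotate F1 a b = (- b, a - b)"
| "rotate F2 a b = (b - a, - a)"

fun theta_rotate :: "nat \<Rightarrow> f3 \<Rightarrow> int \<times> int" where
  "theta_rotate 0 e = rotate e 1 0"
| "theta_rotate (Suc 0) e = rotate e 1 2"
| "theta_rotate (Suc (Suc n)) e = (case theta_rotate n e of (a, b) \<Rightarrow> (- 3 * a, - 3 * b))"

fun eis_neg :: "bool \<Rightarrow> int \<times> int \<Rightarrow> int \<times> int" where
  "eis_neg True (a, b) = (- a, - b)" | "eis_neg False z = z"

fun eis_add :: "int \<times> int \<Rightarrow> int \<times> int \<Rightarrow> int \<times> int" where
  "eis_add (a, b) (c, d) = (a + c, b + d)"

fun mon_eis :: "mon \<Rightarrow> int \<times> int" where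
  "mon_eis (Mon a n e) = eis_neg n (theta_rotate a e)"

lemma eis_add: "eis (eis_add z z') = eis z + eis z'"
  by (cases z; cases z') (simp add: comp_eqs)

lemma eis_rotate: "eis (rotate e a b) = zeta e * eis (a, b)"
  by (cases e) (simp_all add: conjK_mkK omega_def comp_eqs)

lemma eis_theta_rotate: "eis (theta_rotate a e) = \<theta> ^ a * (zeta e :: 'f::field K)"
proof (induction a e rule: theta_rotate.induct)
  case (1 e)
  then show ?case by (simp add: eis_rotate del: eis.simps) (simp add: comp_eqs)
next
  case (2 e)
  have "eis (1, 2) = (\<theta> :: 'f K)"
    by (simp add: theta_def conjK_mkK omega_def comp_eqs)
  then show ?case by (simp add: eis_rotate mult.commute del: eis.simps)
next
  case (3 n e)
  obtain a b where ab: "theta_rotate n e = (a, b)" by fastforce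
  have "\<theta> ^ Suc (Suc n) = - 3 * (\<theta> ^ n :: 'f K)"
  proof -
    have "\<theta> ^ Suc (Suc n) = \<theta>\<^sup>2 * (\<theta> ^ n :: 'f K)"
      by (simp only: power_Suc power2_eq_square mult.assoc)
    then show ?thesis by (simp only: theta_square)
  qed
  moreover have "eis (- 3 * a, - 3 * b) = - 3 * (eis (a, b) :: 'f K)"
    by (simp add: numeral_K comp_eqs)
  ultimately show ?case using 3 by (simp add: ab mult.assoc del: eis.simps power_Suc)
qed

lemma eis_mon: "eis (mon_eis m) = mon_val m"
proof -
  obtain a n e where m: "m = Mon a n e" by (cases m)
  have neg: "eis (eis_neg True z) = - eis z" for z by (cases z) (simp add: comp_eqs)
  show ?thesis
    by (cases n) (simp_all add: m neg eis_theta_rotate del: eis.simps)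
qed

fun same_slot :: "nat \<Rightarrow> f3 \<Rightarrow> bool list \<Rightarrow> formal_term \<Rightarrow> bool" where
  "same_slot t i f (Term t' i' f' m) = (i = i' \<and> t = t' \<and> f = f')"

fun term_eis :: "formal_term \<Rightarrow> int \<times> int" where
  "term_eis (Term t i f m) = mon_eis m"

text \<open>Terms in the same slot, that is with the same summand, coordinate and conjugation flags, are added
  up; every such sum has to vanish. The first argument of \<open>cancels\<close> bounds the number of slots and
  makes the recursion structural.\<close>

fun collect_slot and collect_if where
  "collect_slot t i f [] z R = (z, R)"
| "collect_slot t i f (m # L) z R = collect_if (same_slot t i f m) t i f m L z R"
| "collect_if True t i f m L z R = collect_slot t i f L (eis_add z (term_eis m)) R"
| "collect_if False t i f m L z R = collect_slot t i f L z (m # R)"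

fun cancels and cancels_rest where
  "cancels n [] = True"
| "cancels 0 (m # L) = False"
| "cancels (Suc n) (Term t i f m # L) = cancels_rest n (collect_slot t i f L (mon_eis m) [])"
| "cancels_rest n (z, R) = (z = (0, 0) \<and> cancels n R)"

lemma collect_slot:
  "collect_slot t i f L z R = (z', R') \<Longrightarrow>
     coord t i (eis z' * vars f xs) + sem xs R' = coord t i (eis z * vars f xs) + sem xs L + sem xs R"
  "collect_if b t i f m L z R = (z', R') \<Longrightarrow> b = same_slot t i f m \<Longrightarrow>
     coord t i (eis z' * vars f xs) + sem xs R' =
       coord t i (eis z * vars f xs) + sem1 xs m + sem xs L + sem xs R"
proof (induction t i f L z R and b t i f m L z R rule: collect_slot_collect_if.induct)
  case (3 t i f m L z R)
  then obtain a where "m = Term t i f a" by (cases m) auto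
  with 3 show ?case by (simp add: eis_add eis_mon distrib_right coord_add algebra_simps)
qed (simp_all add: algebra_simps)

lemma cancels_sound:
  "cancels n L \<Longrightarrow> sem xs L = 0"
  "cancels_rest n zR \<Longrightarrow> fst zR = (0, 0) \<and> sem xs (snd zR) = 0"
proof (induction n L and n zR rule: cancels_cancels_rest.induct)
  case (3 n t i f m L)
  obtain z R where zR: "collect_slot t i f L (mon_eis m) [] = (z, R)" by fastforce
  with 3 have "z = (0, 0)" "sem xs R = 0" by auto
  with collect_slot(1)[OF zR, of xs] show ?case by (simp add: eis_mon coord_0 comp_eqs)
qed simp_all


section \<open>The product and its structure constants\<close>

text \<open>\<open>Row d c c' n q0 qii qjj qkk qij qik qjk\<close> describes the component in $V_{t+d}$ of the product of
  $x$ times basis vector $i$ of $V_t$ and $y$ times basis vector $j$ of $V_s$: the scalars $x$ and $y$ are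
  conjugated according to \<open>c\<close> and \<open>c'\<close>, and the coefficient of basis vector $k$ is
  $(-1)^n \omega^q$ where
  $q = q_0 + q_{ii} i^2 + q_{jj} j^2 + q_{kk} k^2 + q_{ij} ij + q_{ik} ik + q_{jk} jk$.
  The numbers $0, 1, 2$ in $\mathbb{F}_3$ stand for $e_1, e_2, e_3$.\<close>

datatype row = Row nat bool bool bool f3 f3 f3 f3 f3 f3 f3

text \<open>Entry $s - t$ of the table belongs to $V_t \times V_s$. The two rows of an entry correspond to the two
  further points of the line through $t$ and $s$. All rows are forced by the value prescribed for
  $[(e_1)_0, (e_1)_1]$: generators carry it to the other coordinate vectors and pairs of summands.\<close>

definition row_table :: "row list list" where
  "row_table =
  [[],
   [Row 3 False False False F2 F1 F0 F1 F2 F1 F0,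
    Row 9 True False True F0 F1 F0 F2 F2 F1 F0],
   [Row 8 True True True F2 F1 F2 F0 F2 F2 F2,
    Row 12 True False False F1 F0 F2 F2 F0 F1 F2],
   [Row 1 True False True F1 F2 F2 F0 F2 F1 F0,
    Row 9 False False False F1 F0 F2 F2 F2 F1 F0],
   [Row 5 False False True F0 F1 F2 F0 F2 F0 F1,
    Row 7 False True False F2 F1 F0 F1 F2 F0 F1],
   [Row 4 True False False F0 F2 F0 F1 F0 F1 F2,
    Row 7 True True True F2 F0 F1 F2 F2 F2 F2],
   [Row 10 True False False F2 F1 F1 F0 F0 F1 F2,
    Row 11 True True True F2 F2 F0 F1 F2 F2 F2],
   [Row 4 False True True F2 F1 F1 F0 F0 F2 F1,
    Row 5 True True False F2 F0 F2 F1 F2 F2 F2],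
   [Row 2 True True False F2 F1 F0 F2 F2 F2 F2,
    Row 12 False True True F0 F0 F2 F1 F0 F2 F1],
   [Row 1 False False False F0 F2 F1 F0 F2 F1 F0,
    Row 3 True False True F2 F0 F1 F1 F2 F1 F0],
   [Row 6 False False True F1 F2 F0 F2 F2 F0 F1,
    Row 11 False True False F1 F2 F2 F0 F2 F0 F1],
   [Row 6 True True False F2 F2 F1 F0 F2 F2 F2,
    Row 10 False True True F1 F2 F0 F2 F0 F2 F1],
   [Row 2 False False True F2 F0 F1 F1 F2 F0 F1,
    Row 8 False True False F0 F0 F1 F2 F2 F0 F1]]"

definition rows :: "nat \<Rightarrow> row list" where
  "rows d = row_table ! d"

text \<open>Reduction modulo $13$ of numbers below $26$, and subtraction modulo $13$ of numbers below $13$, in a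
  form that rewriting with constructor patterns evaluates quickly.\<close>

fun reduce13 :: "nat \<Rightarrow> nat" where
  "reduce13 (Suc (Suc (Suc (Suc (Suc (Suc (Suc (Suc (Suc (Suc (Suc (Suc (Suc n))))))))))))) = n"
| "reduce13 n = n"

fun diff13 :: "nat \<Rightarrow> nat \<Rightarrow> nat" where
  "diff13 s 0 = s"
| "diff13 (Suc s) (Suc t) = diff13 s t"
| "diff13 0 (Suc t) = 12 - t"

text \<open>As a function of $k$, the exponent is \<open>e + l k + q k\<^sup>2\<close>, where $k^2 = 1$ for both nonzero values of $k$.\<close>

fun row_terms :: "nat \<Rightarrow> bool list \<Rightarrow> mon \<Rightarrow> f3 \<Rightarrow> f3 \<Rightarrow> formal_term list \<Rightarrow> formal_term list" where
  "row_terms t f (Mon a n e) l q L =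
     Term t F0 f (Mon a n e) # Term t F1 f (Mon a n (f3_add e (f3_add l q))) #
     Term t F2 f (Mon a n (f3_add e (f3_add (f3_neg l) q))) # L"

fun rows_bracket where
  "rows_bracket t i f m j g m' [] = []"
| "rows_bracket t i f m j g m' (Row d c c' n q0 qii qjj qkk qij qik qjk # R) =
     row_terms (reduce13 (t + d)) (flags_conj c f @ flags_conj c' g)
       (mon_mult (mon_mult (mon_conj c m) (mon_conj c' m'))
         (Mon 0 n (f3_add q0 (f3_add (f3_mult qii (f3_mult i i))
           (f3_add (f3_mult qjj (f3_mult j j)) (f3_mult qij (f3_mult i j)))))))
       (f3_add (f3_mult qik i) (f3_mult qjk j)) qkk
       (rows_bracket t i f m j g m' R)"

fun term_bracket :: "formal_term \<Rightarrow> formal_term \<Rightarrow> formal_term list" where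
  "term_bracket (Term t i f m) (Term s j g m') = rows_bracket t i f m j g m' (rows (diff13 s t))"

abbreviation one_mon :: mon where
  "one_mon \<equiv> Mon 0 False F0"

definition product :: "'f::field V \<Rightarrow> 'f V \<Rightarrow> 'f V" where
  "product u v = (\<Sum>t<13. \<Sum>s<13. \<Sum>i\<in>UNIV. \<Sum>j\<in>UNIV.
     sem [u $ of_nat t $ ix i, v $ of_nat s $ ix j]
       (term_bracket (Term t i [False] one_mon) (Term s j [False] one_mon)))"

lemma sem_row_terms:
  "sem xs (row_terms t f m l q L) =
    coord t F0 (mon_val m * vars f xs) +
    coord t F1 (mon_val m * zeta (f3_add l q) * vars f xs) +
    coord t F2 (mon_val m * zeta (f3_add (f3_neg l) q) * vars f xs) + sem xs L"
  by (cases m) (simp add: zeta_add mult_ac add_ac)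

text \<open>The scalars enter the formal bracket of two terms only through their values, up to conjugation.\<close>

lemma sem_rows_bracket:
  assumes "length f = length xs" "length g = length ys"
  shows "sem (xs @ ys) (rows_bracket t i f m j g m' R) =
    sem [mon_val m * vars f xs, mon_val m' * vars g ys]
      (rows_bracket t i [False] one_mon j [False] one_mon R)"
proof (induction R)
  case (Cons r R)
  obtain d c c' n q0 qii qjj qkk qij qik qjk where
    r: "r = Row d c c' n q0 qii qjj qkk qij qik qjk" by (cases r)
  have one: "mon_mult (mon_mult (mon_conj c one_mon) (mon_conj c' one_mon)) k = k" for k
    by (cases k; cases c; cases c') simp_all
  have fl: "flags_conj c [False] = [c]" for c by (cases c) simp_all
  show ?case
    by (simp only: r rows_bracket.simps sem_row_terms Cons one fl)
       (simp add: vars_append vars_conj assms mon_val_mult mon_val_conj conj_if_hom mult_ac)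
qed simp

lemma conj_if_of_base: "conj_if c (of_base r) = of_base r"
  by (cases c) (simp_all add: conjK_hom)

lemma scaleV_add: "scaleV r (u + v) = scaleV r u + scaleV r v"
  by (simp add: scaleV_def vec_eq_iff distrib_left)

lemma sem_rows_bracket_linear:
  "sem [x + x', y] (rows_bracket t i [False] one_mon j [False] one_mon R) =
    sem [x, y] (rows_bracket t i [False] one_mon j [False] one_mon R) +
    sem [x', y] (rows_bracket t i [False] one_mon j [False] one_mon R)"
  "sem [x, y + y'] (rows_bracket t i [False] one_mon j [False] one_mon R) =
    sem [x, y] (rows_bracket t i [False] one_mon j [False] one_mon R) +
    sem [x, y'] (rows_bracket t i [False] one_mon j [False] one_mon R)"
  "sem [of_base r * x, y] (rows_bracket t i [False] one_mon j [False] one_mon R) =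
    scaleV r (sem [x, y] (rows_bracket t i [False] one_mon j [False] one_mon R))"
  "sem [x, of_base r * y] (rows_bracket t i [False] one_mon j [False] one_mon R) =
    scaleV r (sem [x, y] (rows_bracket t i [False] one_mon j [False] one_mon R))"
proof (induction R)
  case (Cons r R)
  obtain d c c' n q0 qii qjj qkk qij qik qjk where
    r: "r = Row d c c' n q0 qii qjj qkk qij qik qjk" by (cases r)
  have fl: "flags_conj c [False] = [c]" for c by (cases c) simp_all
  note unfold = r rows_bracket.simps sem_row_terms Cons fl scaleV_add scaleV_coord
  note expand = conj_if_hom conj_if_of_base distrib_left distrib_right coord_add add_ac mult_ac
  {
    case 1 show ?case unfolding unfold by (simp add: expand)
  next
    case 2 show ?case unfolding unfold by (simp add: expand)
  next
    case 3 show ?case unfolding unfold by (simp add: expand)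
  next
    case 4 show ?case unfolding unfold by (simp add: expand)
  }
qed (simp_all add: scaleV_def vec_eq_iff)

lemma product_coord:
  assumes "t < 13" "s < 13"
  shows "product (coord t i x) (coord s j y) =
    sem [x, y] (term_bracket (Term t i [False] one_mon) (Term s j [False] one_mon))"
proof -
  have zero: "sem [0, y] (rows_bracket t i [False] one_mon j [False] one_mon R) = 0"
    "sem [x, 0] (rows_bracket t i [False] one_mon j [False] one_mon R) = 0" for x y t i j R
    using sem_rows_bracket_linear(1)[of 0 0] sem_rows_bracket_linear(2)[of _ 0 0] by simp_all
  let ?F = "\<lambda>t' s' i' j'. sem [coord t i x $ of_nat t' $ ix i', coord s j y $ of_nat s' $ ix j']
    (term_bracket (Term t' i' [False] one_mon) (Term s' j' [False] one_mon))"
  have F: "?F t' s' i' j' = 0"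
    if "t' \<noteq> t \<or> s' \<noteq> s \<or> i' \<noteq> i \<or> j' \<noteq> j" "t' < 13" "s' < 13" for t' s' i' j'
    using that assms by (auto simp: coord_component zero)
  have single: "sum f A = f a" if "finite A" "a \<in> A" "\<And>b. b \<in> A \<Longrightarrow> b \<noteq> a \<Longrightarrow> f b = 0"
    for f :: "'b \<Rightarrow> 'a V" and A a
    using that by (simp add: sum.remove)
  have "product (coord t i x) (coord s j y) = (\<Sum>s'<13. \<Sum>i'\<in>UNIV. \<Sum>j'\<in>UNIV. ?F t s' i' j')"
    unfolding product_def by (rule single) (auto simp: assms F intro!: sum.neutral simp del: term_bracket.simps)
  also have "\<dots> = (\<Sum>i'\<in>UNIV. \<Sum>j'\<in>UNIV. ?F t s i' j')"
    by (rule single) (auto simp: assms F intro!: sum.neutral simp del: term_bracket.simps)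
  also have "\<dots> = (\<Sum>j'\<in>UNIV. ?F t s i j')"
    by (rule single) (auto simp: assms F intro!: sum.neutral simp del: term_bracket.simps)
  also have "\<dots> = ?F t s i j"
    by (rule single) (auto simp: assms F simp del: term_bracket.simps)
  finally show ?thesis by (simp add: coord_component assms)
qed

lemma product_add: "product (u + u') v = product u v + product u' v"
  "product u (v + v') = product u v + product u v'"
  unfolding product_def term_bracket.simps vector_add_component sem_rows_bracket_linear
  by (simp_all only: sum.distrib)

lemma scaleV_sum: "scaleV r (sum f A) = (\<Sum>a\<in>A. scaleV r (f a))"
  by (induction A rule: infinite_finite_induct) (simp_all add: scaleV_add, simp_all add: scaleV_def vec_eq_iff)

lemma scaleV_component: "scaleV r v $ t $ k = of_base r * v $ t $ k"
  by (simp add: scaleV_def)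

lemma product_scaleV: "product (scaleV r u) v = scaleV r (product u v)"
  "product u (scaleV r v) = scaleV r (product u v)"
  unfolding product_def term_bracket.simps scaleV_component sem_rows_bracket_linear scaleV_sum
  by (rule refl)+

lemma product_bilinear: "F_bilinear product"
  unfolding F_bilinear_def by (intro conjI allI F_linearI product_add product_scaleV)

lemma product_zero: "product 0 v = 0" "product u 0 = 0"
  using product_add(1)[of 0 0] product_add(2)[of _ 0 0] by simp_all

fun terms_bracket1 :: "formal_term \<Rightarrow> formal_term list \<Rightarrow> formal_term list" where
  "terms_bracket1 x [] = []"
| "terms_bracket1 x (y # Y) = term_bracket x y @ terms_bracket1 x Y"

fun terms_bracket :: "formal_term list \<Rightarrow> formal_term list \<Rightarrow> formal_term list" where
  "terms_bracket [] Y = []"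
| "terms_bracket (x # X) Y = terms_bracket1 x Y @ terms_bracket X Y"

fun wf_term :: "nat \<Rightarrow> formal_term \<Rightarrow> bool" where
  "wf_term n (Term t i f m) = (t < 13 \<and> length f = n)"

lemma term_bracket_sem:
  assumes "wf_term (length xs) x" "wf_term (length ys) y"
  shows "sem (xs @ ys) (term_bracket x y) = product (sem1 xs x) (sem1 ys y)"
proof -
  obtain t i f m s j g m' where xy: "x = Term t i f m" "y = Term s j g m'"
    by (cases x; cases y) auto
  with assms have "t < 13" "s < 13" "length f = length xs" "length g = length ys" by auto
  then show ?thesis
    by (simp add: xy product_coord sem_rows_bracket)
qed

lemma terms_bracket_sem:
  assumes "list_all (wf_term (length xs)) X" "list_all (wf_term (length ys)) Y"
  shows "sem (xs @ ys) (terms_bracket X Y) = product (sem xs X) (sem ys Y)"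
proof -
  have "sem (xs @ ys) (terms_bracket1 x Y) = product (sem1 xs x) (sem ys Y)"
    if "wf_term (length xs) x" for x
    using assms(2)
    by (induction Y) (simp_all add: product_zero product_add term_bracket_sem[OF that])
  then show ?thesis
    using assms(1) by (induction X) (simp_all add: product_zero product_add)
qed

lemma reduce13_less: "n < 26 \<Longrightarrow> reduce13 n < 13"
  by (cases n rule: reduce13.cases) simp_all

lemma rows_offset:
  assumes "d < 13"
  shows "list_all (\<lambda>r. case r of Row d c c' n q0 qii qjj qkk qij qik qjk \<Rightarrow> d < 13) (rows d)"
proof -
  have "list_all (list_all (\<lambda>r. case r of Row d c c' n q0 qii qjj qkk qij qik qjk \<Rightarrow> d < 13))
      row_table" "length row_table = 13"
    by (simp_all add: row_table_def)
  then show ?thesis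
    using assms by (simp add: rows_def list_all_length)
qed

lemma diff13_less: "s < 13 \<Longrightarrow> t < 13 \<Longrightarrow> diff13 s t < 13"
  by (induction s t rule: diff13.induct) simp_all

lemma wf_term_bracket:
  assumes "wf_term n x" "wf_term m y"
  shows "list_all (wf_term (n + m)) (term_bracket x y)"
proof -
  obtain t i f a s j g b where xy: "x = Term t i f a" "y = Term s j g b"
    by (cases x; cases y) auto
  with assms have t: "t < 13" and s: "s < 13" and l: "length f = n" "length g = m" by auto
  have "list_all (\<lambda>r. case r of Row d c c' n q0 qii qjj qkk qij qik qjk \<Rightarrow> d < 13) R \<Longrightarrow>
      list_all (wf_term (n + m)) (rows_bracket t i f a j g b R)" for R
  proof (induction R)
    case (Cons r R)
    obtain d c c' n q0 qii qjj qkk qij qik qjk where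
      r: "r = Row d c c' n q0 qii qjj qkk qij qik qjk" by (cases r)
    have "list_all (wf_term k) (row_terms t' f' m' q q' L)"
      if "t' < 13" "length f' = k" "list_all (wf_term k) L" for t' f' m' q q' L k
      using that by (cases m') simp
    then show ?case
      using Cons t l by (simp add: r reduce13_less)
  qed simp
  then show ?thesis
    using rows_offset[OF diff13_less[OF s t]] by (simp add: xy)
qed

section \<open>Antisymmetry and invariance as formal identities\<close>

text \<open>\<open>Block t c A A' A''\<close> describes the restriction of a semilinear map to one summand: the target is $V_t$,
  the flag \<open>c\<close> says whether scalars are conjugated, and the lists give the nonzero coordinates of the
  images of $e_1$, $e_2$ and $e_3$.\<close>

datatype block = Block nat bool "(f3 \<times> mon) list" "(f3 \<times> mon) list" "(f3 \<times> mon) list"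

fun column_terms :: "nat \<Rightarrow> bool list \<Rightarrow> mon \<Rightarrow> (f3 \<times> mon) list \<Rightarrow> formal_term list" where
  "column_terms t f m [] = []"
| "column_terms t f m ((k, l) # A) = Term t k f (mon_mult m l) # column_terms t f m A"

fun block_terms :: "block \<Rightarrow> f3 \<Rightarrow> bool list \<Rightarrow> mon \<Rightarrow> formal_term list" where
  "block_terms (Block t c A A' A'') F0 f m = column_terms t (flags_conj c f) (mon_conj c m) A"
| "block_terms (Block t c A A' A'') F1 f m = column_terms t (flags_conj c f) (mon_conj c m) A'"
| "block_terms (Block t c A A' A'') F2 f m = column_terms t (flags_conj c f) (mon_conj c m) A''"

fun term_act :: "(nat \<Rightarrow> block) \<Rightarrow> formal_term \<Rightarrow> formal_term list" where
  "term_act b (Term t i f m) = block_terms (b t) i f m"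

fun terms_act :: "(nat \<Rightarrow> block) \<Rightarrow> formal_term list \<Rightarrow> formal_term list" where
  "terms_act b [] = []"
| "terms_act b (x # X) = term_act b x @ terms_act b X"

fun terms_scale :: "mon \<Rightarrow> formal_term list \<Rightarrow> formal_term list" where
  "terms_scale c [] = []"
| "terms_scale c (Term t i f m # X) = Term t i f (mon_mult c m) # terms_scale c X"

text \<open>The factor \<open>r\<close> clears denominators. It is $3$ for $c$ and $1$ for the other generators.\<close>

definition represents :: "'f::field \<Rightarrow> (nat \<Rightarrow> block) \<Rightarrow> ('f V \<Rightarrow> 'f V) \<Rightarrow> bool" where
  "represents r b g \<longleftrightarrow> (\<forall>t<13. \<forall>i x.
     scaleV r (g (coord t i x)) = sem [x] (term_act b (Term t i [False] one_mon)))"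

lemma sem_term_act: "sem xs (term_act b (Term t i f m)) =
    sem [mon_val m * vars f xs] (term_act b (Term t i [False] one_mon))"
proof -
  have one: "mon_mult (mon_conj c one_mon) l = l" for c l
    by (cases l; cases c) simp_all
  have fl: "flags_conj c [False] = [c]" for c by (cases c) simp_all
  have "sem xs (column_terms t' (flags_conj c f) (mon_conj c m) A) =
      sem [mon_val m * vars f xs] (column_terms t' [c] (mon_conj c one_mon) A)" for t' c A
    by (induction A)
       (auto simp: one mon_val_mult mon_val_conj vars_conj conj_if_hom mult_ac)
  then show ?thesis
    by (cases "b t"; cases i) (simp_all add: fl)
qed

lemma represents_term:
  assumes "represents r b g" "wf_term n x"
  shows "scaleV r (g (sem1 xs x)) = sem xs (term_act b x)"
proof -
  obtain t i f m where x: "x = Term t i f m" by (cases x)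
  then have "t < 13" using assms(2) by simp
  then show ?thesis
    using assms(1) by (simp only: represents_def x sem1.simps sem_term_act[of xs])
qed

lemma F_linear_simps:
  assumes "F_linear g"
  shows "g (u + v) = g u + g v" "g (scaleV r u) = scaleV r (g u)" "g 0 = 0" "g (- u) = - g u"
    "g (u - v) = g u - g v"
proof -
  interpret Vector_Spaces.linear scaleV scaleV g by (rule assms)
  show "g (u + v) = g u + g v" "g (scaleV r u) = scaleV r (g u)" "g 0 = 0" "g (- u) = - g u"
    "g (u - v) = g u - g v"
    by (rule add scale zero neg diff)+
qed

lemma scaleV_simps:
  "scaleV r 0 = 0" "scaleV (- r) u = - scaleV r u" "scaleV r (u - v) = scaleV r u - scaleV r v"
  "scaleV r (- u) = - scaleV r u" "scaleV r (scaleV s u) = scaleV (r * s) u" "scaleV 1 u = u"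
  "scaleV (r - s) u = scaleV r u - scaleV s u"
  by (simp_all add: scaleV_def vec_eq_iff of_base_hom algebra_simps)

lemma scaleV_cancel: "r \<noteq> 0 \<Longrightarrow> scaleV r u = scaleV r v \<longleftrightarrow> u = v"
  by (metis scaleV_simps(5,6) left_inverse)

lemma represents_terms:
  assumes "represents r b g" "F_linear g" "list_all (wf_term n) X"
  shows "scaleV r (g (sem xs X)) = sem xs (terms_act b X)"
  using assms(3)
  by (induction X)
     (simp_all add: F_linear_simps[OF assms(2)] scaleV_simps scaleV_add represents_term[OF assms(1), of n])

lemma sem_scale:
  assumes "mon_val c = of_base r"
  shows "sem xs (terms_scale c X) = scaleV r (sem xs X)"
proof (induction X)
  case (Cons x X)
  then show ?case
    by (cases x) (simp add: scaleV_add scaleV_coord mon_val_mult assms mult_ac)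
qed (simp add: scaleV_simps)

text \<open>If the blocks represent $r g$, then the first list of terms stands for $r^2 [x^g, y^g]$ and
  \<open>terms_act\<close> of the bracket for $r [x, y]^g$. So \<open>c\<close> must have the value $-r$.\<close>

fun invariant_terms :: "(nat \<Rightarrow> block) \<Rightarrow> mon \<Rightarrow> formal_term \<Rightarrow> formal_term \<Rightarrow> bool" where
  "invariant_terms b c x y =
     (list_all (wf_term 1) (term_act b x) \<and> list_all (wf_term 1) (term_act b y) \<and>
      cancels 99 (terms_bracket (term_act b x) (term_act b y) @
        terms_scale c (terms_act b (term_bracket x y))))"

text \<open>The bracket of \<open>y\<close> and \<open>x\<close> lists the variable of \<open>y\<close> first; reversing the flags restores the
  common order of the variables.\<close>

fun terms_swap :: "formal_term list \<Rightarrow> formal_term list" where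
  "terms_swap [] = []"
| "terms_swap (Term t i f m # X) = Term t i (rev f) m # terms_swap X"

fun antisymmetric_terms :: "formal_term \<Rightarrow> formal_term \<Rightarrow> bool" where
  "antisymmetric_terms x y = cancels 99 (term_bracket x y @ terms_swap (term_bracket y x))"

text \<open>Pairs with $t \leq s$ suffice, as antisymmetry supplies the others.\<close>

definition for_all_pairs :: "(formal_term \<Rightarrow> formal_term \<Rightarrow> bool) \<Rightarrow> bool" where
  "for_all_pairs P \<longleftrightarrow>
     (\<forall>t\<in>set [0..<13]. \<forall>s\<in>set [t..<13]. \<forall>i\<in>set [F0, F1, F2]. \<forall>j\<in>set [F0, F1, F2].
       P (Term t i [False] one_mon) (Term s j [False] one_mon))"

lemma for_all_pairsD:
  assumes "for_all_pairs P" "t \<le> s" "s < 13"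
  shows "P (Term t i [False] one_mon) (Term s j [False] one_mon)"
proof -
  have "i \<in> set [F0, F1, F2]" "j \<in> set [F0, F1, F2]" by (cases i; simp) (cases j; simp)
  moreover have "t \<in> set [0..<13]" "s \<in> set [t..<13]" using assms(2,3) by auto
  ultimately show ?thesis using assms(1) unfolding for_all_pairs_def by blast
qed

lemma sem1_unit: "sem1 [x] (Term t i [False] one_mon) = coord t i x"
  by simp

lemma sem_swap:
  assumes "list_all (wf_term 2) X"
  shows "sem [x, y] (terms_swap X) = sem [y, x] X"
  using assms
proof (induction X rule: terms_swap.induct)
  case (2 t i f m X)
  then obtain a b where "f = [a, b]"
    by (auto simp: length_Suc_conv numeral_2_eq_2)
  with 2 show ?case by (simp add: mult.commute)
qed simp

lemma product_antisym:
  assumes "for_all_pairs antisymmetric_terms"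
  shows "product u v = - product v u"
proof -
  have le: "product (coord t i x) (coord s j y) + product (coord s j y) (coord t i x) = 0"
    if ts: "t \<le> s" "s < 13" for t i x s j y
  proof -
    let ?x = "Term t i [False] one_mon" and ?y = "Term s j [False] one_mon"
    have wf: "list_all (wf_term 2) (term_bracket ?y ?x)"
      using wf_term_bracket[of 1 ?y 1 ?x] ts by (simp add: numeral_2_eq_2)
    have "sem [x, y] (term_bracket ?x ?y @ terms_swap (term_bracket ?y ?x)) = 0"
      using for_all_pairsD[OF assms ts, of i j]
      unfolding antisymmetric_terms.simps by (rule cancels_sound)
    then show ?thesis
      using ts by (simp add: product_coord sem_swap[OF wf] del: term_bracket.simps)
  qed
  have basis: "product (coord t i x) (coord s j y) + product (coord s j y) (coord t i x) = 0"
    if "t < 13" "s < 13" for t i x s j y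
    using le[of t s i x j y] le[of s t j y i x] that by (cases "t \<le> s") (auto simp: add.commute)
  have "product (coord t i x) v + product v (coord t i x) = 0" if "t < 13" for t i x
    by (induction v rule: V_induct) (simp_all add: product_add basis that algebra_simps)
  then have "product u v + product v u = 0"
    by (induction u rule: V_induct) (simp_all add: product_add algebra_simps)
  then show ?thesis
    by (simp add: eq_neg_iff_add_eq_0)
qed

lemma product_invariantI:
  fixes g :: "'f::field V \<Rightarrow> 'f V"
  assumes r: "r \<noteq> 0" and g: "F_linear g" "represents r b g"
    and c: "mon_val c = of_base (- r)" and check: "for_all_pairs (invariant_terms b c)"
    and antisym: "for_all_pairs antisymmetric_terms"
  shows "product (g u) (g v) = g (product u v)"
proof -
  note glin = F_linear_simps[OF g(1)]
  have le: "product (g (coord t i x)) (g (coord s j y)) = g (product (coord t i x) (coord s j y))"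
    if ts: "t \<le> s" "s < 13" for t i x s j y
  proof -
    let ?x = "Term t i [False] one_mon" and ?y = "Term s j [False] one_mon"
    let ?X = "coord t i x" and ?Y = "coord s j y"
    have "t < 13" using ts by simp
    then have wfx: "wf_term 1 ?x" and wfy: "wf_term 1 ?y" using ts by simp_all
    have wfxy: "list_all (wf_term 2) (term_bracket ?x ?y)"
      using wf_term_bracket[OF wfx wfy] by (simp add: numeral_2_eq_2)
    have len: "length [z] = 1" for z :: "'f K" by simp
    have "invariant_terms b c ?x ?y" by (rule for_all_pairsD[OF check ts])
    then have wf: "list_all (wf_term (length [x])) (term_act b ?x)"
        "list_all (wf_term (length [y])) (term_act b ?y)"
      and cancels: "cancels 99 (terms_bracket (term_act b ?x) (term_act b ?y) @
        terms_scale c (terms_act b (term_bracket ?x ?y)))"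
      unfolding invariant_terms.simps len by blast+
    have "sem [x, y] (terms_bracket (term_act b ?x) (term_act b ?y)) +
        sem [x, y] (terms_scale c (terms_act b (term_bracket ?x ?y))) = 0"
      unfolding sem_simps(3)[symmetric] by (rule cancels_sound(1)[OF cancels])
    moreover have "sem [x, y] (terms_bracket (term_act b ?x) (term_act b ?y)) =
        scaleV r (scaleV r (product (g ?X) (g ?Y)))"
    proof -
      have "sem ([x] @ [y]) (terms_bracket (term_act b ?x) (term_act b ?y)) =
          product (scaleV r (g ?X)) (scaleV r (g ?Y))"
        unfolding terms_bracket_sem[OF wf] represents_term[OF g(2) wfx, symmetric]
          represents_term[OF g(2) wfy, symmetric] sem1_unit ..
      then show ?thesis
        by (simp only: product_scaleV append_Cons append_Nil)
    qed
    moreover have "sem [x, y] (terms_scale c (terms_act b (term_bracket ?x ?y))) =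
        - scaleV r (scaleV r (g (product ?X ?Y)))"
      unfolding sem_scale[OF c] represents_terms[OF g(2,1) wfxy, symmetric]
        product_coord[OF \<open>t < 13\<close> ts(2)] scaleV_simps(2) ..
    ultimately have "scaleV r (scaleV r (product (g ?X) (g ?Y))) =
        scaleV r (scaleV r (g (product ?X ?Y)))"
      by simp
    then show ?thesis
      unfolding scaleV_cancel[OF r] .
  qed
  have basis: "product (g (coord t i x)) (g (coord s j y)) = g (product (coord t i x) (coord s j y))"
    if "t < 13" "s < 13" for t i x s j y
  proof (cases "t \<le> s")
    case False
    then have "product (g (coord s j y)) (g (coord t i x)) = g (product (coord s j y) (coord t i x))"
      using le that by simp
    then show ?thesis
      using product_antisym[OF antisym] glin(4) by metis
  qed (use le that in simp)
  have "product (g (coord t i x)) (g v) = g (product (coord t i x) v)" if "t < 13" for t i x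
    by (induction v rule: V_induct) (simp_all add: product_add glin basis that)
  then show ?thesis
    by (induction u rule: V_induct) (simp_all add: product_add glin)
qed

section \<open>The blocks of the five generators\<close>

text \<open>The \<open>n\<close>-th entries of \<open>block_table_c\<close> and \<open>block_table_e\<close> belong to $V_n$. The entries of
  \<open>block_table_c\<close> describe $3c$: there \<open>Mon 2 False e\<close> is $-3\omega^e$, and the factor $\theta/3$ of the
  four matrices becomes $\theta$.\<close>

definition blocks_a :: "nat \<Rightarrow> block" where
  "blocks_a t = Block (reduce13 (Suc t)) False [(F0, one_mon)] [(F1, one_mon)] [(F2, one_mon)]"

definition blocks_b :: "nat \<Rightarrow> block" where
  "blocks_b t = Block (3 * t mod 13) False
     [(F0, Mon 0 False F1)] [(F1, Mon 0 False F2)] [(F2, Mon 0 False F2)]"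

definition blocks_d :: "nat \<Rightarrow> block" where
  "blocks_d t = (let l = Mon 0 False ([F0, F1, F0, F1, F1, F1, F2, F2, F0, F1, F2, F1, F0] ! t)
     in Block t False [(F0, l)] [(F1, l)] [(F2, l)])"

definition block_table_c :: "block list" where
  "block_table_c =
  [Block 0 True [(F0, Mon 2 False F0)] [(F2, Mon 2 False F0)] [(F1, Mon 2 False F0)],
   Block 1 False [(F0, Mon 2 False F0)] [(F2, Mon 2 False F0)] [(F1, Mon 2 False F0)],
   Block 2 True [(F0, Mon 1 False F1), (F1, Mon 1 False F0), (F2, Mon 1 False F0)]
      [(F0, Mon 1 False F0), (F1, Mon 1 False F1), (F2, Mon 1 False F0)]
      [(F0, Mon 1 False F0), (F1, Mon 1 False F0), (F2, Mon 1 False F1)],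
   Block 9 False [(F0, Mon 2 False F1)] [(F2, Mon 2 False F2)] [(F1, Mon 2 False F2)],
   Block 10 True [(F0, Mon 2 True F0)] [(F1, Mon 2 True F0)] [(F2, Mon 2 True F0)],
   Block 6 True [(F0, Mon 1 False F1), (F1, Mon 1 False F1), (F2, Mon 1 False F1)]
      [(F0, Mon 1 False F2), (F1, Mon 1 False F1), (F2, Mon 1 False F0)]
      [(F0, Mon 1 False F2), (F1, Mon 1 False F0), (F2, Mon 1 False F1)],
   Block 5 True [(F0, Mon 1 False F1), (F1, Mon 1 False F2), (F2, Mon 1 False F2)]
      [(F0, Mon 1 False F1), (F1, Mon 1 False F1), (F2, Mon 1 False F0)]
      [(F0, Mon 1 False F1), (F1, Mon 1 False F0), (F2, Mon 1 False F1)],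
   Block 11 True [(F0, Mon 1 False F0), (F1, Mon 1 False F1), (F2, Mon 1 False F1)]
      [(F0, Mon 1 False F2), (F1, Mon 1 False F2), (F2, Mon 1 False F1)]
      [(F0, Mon 1 False F2), (F1, Mon 1 False F1), (F2, Mon 1 False F2)],
   Block 8 True [(F0, Mon 1 False F0), (F1, Mon 1 False F0), (F2, Mon 1 False F0)]
      [(F0, Mon 1 False F0), (F1, Mon 1 False F2), (F2, Mon 1 False F1)]
      [(F0, Mon 1 False F0), (F1, Mon 1 False F1), (F2, Mon 1 False F2)],
   Block 3 False [(F0, Mon 2 False F2)] [(F2, Mon 2 False F1)] [(F1, Mon 2 False F1)],
   Block 4 True [(F0, Mon 2 True F0)] [(F1, Mon 2 True F0)] [(F2, Mon 2 True F0)],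
   Block 7 True [(F0, Mon 1 False F0), (F1, Mon 1 False F2), (F2, Mon 1 False F2)]
      [(F0, Mon 1 False F1), (F1, Mon 1 False F2), (F2, Mon 1 False F1)]
      [(F0, Mon 1 False F1), (F1, Mon 1 False F1), (F2, Mon 1 False F2)],
   Block 12 True [(F0, Mon 2 True F0)] [(F1, Mon 2 True F0)] [(F2, Mon 2 True F0)]]"

definition block_table_e :: "block list" where
  "block_table_e =
  [Block 0 False [(F0, Mon 0 False F0)] [(F1, Mon 0 False F0)] [(F2, Mon 0 False F0)],
   Block 1 False [(F1, Mon 0 False F0)] [(F2, Mon 0 False F0)] [(F0, Mon 0 False F0)],
   Block 2 False [(F2, Mon 0 False F1)] [(F0, Mon 0 False F2)] [(F1, Mon 0 False F0)],
   Block 3 False [(F1, Mon 0 False F1)] [(F2, Mon 0 False F0)] [(F0, Mon 0 False F2)],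
   Block 4 False [(F0, Mon 0 False F0)] [(F1, Mon 0 False F1)] [(F2, Mon 0 False F2)],
   Block 5 False [(F2, Mon 0 False F0)] [(F0, Mon 0 False F0)] [(F1, Mon 0 False F0)],
   Block 6 False [(F2, Mon 0 False F2)] [(F0, Mon 0 False F1)] [(F1, Mon 0 False F0)],
   Block 7 False [(F1, Mon 0 False F1)] [(F2, Mon 0 False F0)] [(F0, Mon 0 False F2)],
   Block 8 False [(F1, Mon 0 False F2)] [(F2, Mon 0 False F0)] [(F0, Mon 0 False F1)],
   Block 9 False [(F1, Mon 0 False F2)] [(F2, Mon 0 False F0)] [(F0, Mon 0 False F1)],
   Block 10 False [(F0, Mon 0 False F0)] [(F1, Mon 0 False F1)] [(F2, Mon 0 False F2)],
   Block 11 False [(F1, Mon 0 False F0)] [(F2, Mon 0 False F0)] [(F0, Mon 0 False F0)],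
   Block 12 False [(F0, Mon 0 False F0)] [(F1, Mon 0 False F1)] [(F2, Mon 0 False F2)]]"

definition blocks_c :: "nat \<Rightarrow> block" where
  "blocks_c t = block_table_c ! t"

definition blocks_e :: "nat \<Rightarrow> block" where
  "blocks_e t = block_table_e ! t"

lemma from_summands_single:
  assumes "\<And>s. f s 0 = 0"
  shows "from_summands f (axis t v) = f t v"
proof -
  have "from_summands f (axis t v) = (\<Sum>s\<in>UNIV. if s = t then f t v else 0)"
    unfolding from_summands_def by (intro sum.cong refl) (auto simp: axis_def assms)
  then show ?thesis by simp
qed

lemma axis_plus: "axis t u + axis t v = axis t (u + v :: 'f::field K^3)"
  by (simp add: axis_def vec_eq_iff)

lemma axis_zero: "axis t 0 = 0"
  by (simp add: axis_def vec_eq_iff)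

lemma scaleV_axis: "scaleV r (axis t v) = axis t (of_base r *s v)"
  by (simp add: scaleV_def vec_eq_iff axis_def)

lemma point_cases:
  assumes "t < (13::nat)"
  obtains "t = 0" | "t = 1" | "t = 2" | "t = 3" | "t = 4" | "t = 5" | "t = 6" | "t = 7" |
    "t = 8" | "t = 9" | "t = 10" | "t = 11" | "t = 12"
proof -
  have "t \<in> {0, 1, 2, 3, 4, 5, 6, 7, 8, 9, 10, 11, 12}"
    using assms by (simp, presburger)
  then show ?thesis using that by (elim insertE) (simp_all only: empty_iff)
qed

lemma of_nat_mod13: "of_nat (n mod 13) = (of_nat n :: 13)"
proof -
  have "(of_nat n :: 13) = of_nat (13 * (n div 13) + n mod 13)" by simp
  also have "\<dots> = 13 * of_nat (n div 13) + of_nat (n mod 13)"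
    by (simp only: of_nat_add of_nat_mult of_nat_numeral)
  finally show ?thesis by (simp only: thirteen_simps mult_zero_left add_0)
qed

lemma reduce13_mod: "n < 26 \<Longrightarrow> reduce13 n = n mod 13"
  by (cases n rule: reduce13.cases) simp_all

lemma represents_a: "represents 1 blocks_a gen_a"
  unfolding represents_def
proof (intro allI impI)
  fix t :: nat and i and x :: "'a K"
  assume t: "t < 13"
  have "gen_a (coord t i x) = axis (of_nat t + 1) (axis (ix i) x)"
    unfolding gen_a_def coord_def by (rule from_summands_single) (rule axis_zero)
  moreover have "of_nat (reduce13 (Suc t)) = (of_nat t + 1 :: 13)"
    using t by (simp add: reduce13_mod of_nat_mod13 add.commute)
  ultimately show "scaleV 1 (gen_a (coord t i x)) =
      sem [x] (term_act blocks_a (Term t i [False] one_mon))"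
    by (cases i) (simp_all add: blocks_a_def scaleV_simps coord_def)
qed

lemma represents_b: "represents 1 blocks_b gen_b"
  unfolding represents_def
proof (intro allI impI)
  fix t :: nat and i and x :: "'a K"
  have "gen_b (coord t i x) = axis (3 * of_nat t) (row3 (\<omega> * axis (ix i) x $ 1)
      (\<omega>_bar * axis (ix i) x $ 2) (\<omega>_bar * axis (ix i) x $ 3))"
    unfolding gen_b_def coord_def
    by (rule from_summands_single) (simp add: vec_eq_iff axis_def forall_3)
  then show "scaleV 1 (gen_b (coord t i x)) =
      sem [x] (term_act blocks_b (Term t i [False] one_mon))"
    by (cases i) (simp_all add: blocks_b_def scaleV_simps coord_def of_nat_mod13 vec_eq_iff
        axis_def forall_3)
qed

lemma represents_d: "represents 1 blocks_d gen_d"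
  unfolding represents_def
proof (intro allI impI)
  fix t :: nat and i and x :: "'a K"
  assume t: "t < 13"
  have g: "gen_d (coord t i x) = axis (of_nat t) (delta (of_nat t) *s axis (ix i) x)"
    unfolding gen_d_def coord_def by (rule from_summands_single) (simp add: axis_zero)
  have "delta (of_nat t) = (zeta ([F0, F1, F0, F1, F1, F1, F2, F2, F0, F1, F2, F1, F0] ! t) :: 'a K)"
    using t by (elim point_cases) (simp_all add: delta_def)
  then show "scaleV 1 (gen_d (coord t i x)) =
      sem [x] (term_act blocks_d (Term t i [False] one_mon))"
    unfolding g scaleV_simps
    by (cases i) (simp_all add: blocks_d_def Let_def coord_def, simp_all add: vec_eq_iff axis_def)
qed

lemma represents_e: "represents 1 blocks_e gen_e"
  unfolding represents_def
proof (intro allI impI)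
  fix t :: nat and i and x :: "'a K"
  assume t: "t < 13"
  have eq: "gen_e = from_summands (\<lambda>t v. axis t (block_e t v))"
    unfolding gen_e_def block_e_def Let_def ..
  have g: "gen_e (coord t i x) = axis (of_nat t) (block_e (of_nat t) (axis (ix i) x))"
    unfolding eq coord_def
    by (rule from_summands_single)
       (simp add: block_e_def Let_def vec_eq_iff forall_3 axis_def)
  show "scaleV 1 (gen_e (coord t i x)) =
      sem [x] (term_act blocks_e (Term t i [False] one_mon))"
    unfolding g scaleV_simps using t
    by (elim point_cases; cases i)
       (simp_all add: blocks_e_def block_table_e_def coord_def axis_plus block_e_def
         vec_eq_iff forall_3, simp_all add: axis_def)
qed

lemma c_block: "gen_c (axis t v) = (let x = v$1; y = v$2; z = v$3; v' = row3 (conjK x) (conjK y) (conjK z) in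
    if t = 0 then axis 0 (- row3 (conjK x) (conjK z) (conjK y))
    else if t = 1 then axis 1 (- row3 x z y)
    else if t = 3 then axis 9 (- row3 (\<omega> * x) (\<omega>_bar * z) (\<omega>_bar * y))
    else if t = 9 then axis 3 (- row3 (\<omega>_bar * x) (\<omega> * z) (\<omega> * y))
    else if t = 4 then axis 10 v'
    else if t = 10 then axis 4 v'
    else if t = 12 then axis 12 v'
    else if t = 2 then axis 2 (v' v* M1)
    else if t = 8 then axis 8 (v' v* M2)
    else if t = 5 then axis 6 (v' v* M3)
    else if t = 6 then axis 5 (v' v* transpose M3)
    else if t = 7 then axis 11 (v' v* M4)
    else axis 7 (v' v* transpose M4))"
  unfolding gen_c_def
proof (rule from_summands_single, goal_cases)
  case (1 s)
  have z: "row3 0 0 0 = (0 :: 'a K^3)" by (simp add: vec_eq_iff forall_3)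
  have zM: "0 v* A = (0 :: 'a K^3)" for A :: "'a K^3^3"
    by (simp add: vector_matrix_mult_def vec_eq_iff)
  show ?case by (simp add: Let_def conjK_0 z zM axis_zero del: vector_transpose_matrix)
qed

lemma represents_c:
  assumes "(3 :: 'f::field) \<noteq> 0"
  shows "represents 3 blocks_c (gen_c :: 'f V \<Rightarrow> 'f V)"
  unfolding represents_def
proof (intro allI impI)
  fix t :: nat and i and x :: "'f K"
  assume t: "t < 13"
  define tau :: "'f K" where "tau = \<theta> * of_base (1 / 3)"
  have third: "theta_third A $ j $ k = tau * A $ j $ k" for A j k
    by (simp add: theta_third_def tau_def)
  have "of_base 3 * of_base (1 / 3) = (1 :: 'f K)"
    using assms by (simp add: of_base_hom(2) flip: of_base_hom(4))
  then have theta: "\<theta> = of_base 3 * tau"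
    by (metis tau_def mult.left_commute mult.right_neutral)
  have three: "of_base 3 = (3 :: 'f K)"
    by (simp add: of_base_def numeral_K)
  have sq: "\<theta> * (\<theta> * y) = - 3 * (y :: 'f K)" for y
    by (metis theta_square power2_eq_square mult.assoc)
  have mons: "mon_val (Mon (Suc (Suc 0)) n e) = (of_base 3 * (if n then 1 else - 1) * zeta e :: 'f K)" for n e
    by (simp add: three sq mult.assoc)
  have mons1: "mon_val (Mon (Suc 0) False e) = (of_base 3 * tau * zeta e :: 'f K)" for e
    by (simp add: theta)
  have vM: "(v v* A) $ k = v $ 1 * A $ 1 $ k + v $ 2 * A $ 2 $ k + v $ 3 * A $ 3 $ k"
    for v :: "'f K^3" and A :: "'f K^3^3" and k
    by (simp add: vector_matrix_mult_def sum_3 mult.commute)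
  have tr: "transpose A $ j $ k = A $ k $ j" for A :: "'f K^3^3" and j k
    by (simp add: transpose_def)
  show "scaleV 3 (gen_c (coord t i x)) =
      sem [x] (term_act blocks_c (Term t i [False] one_mon))"
    unfolding coord_def c_block using t
    by (elim point_cases; cases i)
       (simp_all add: blocks_c_def block_table_c_def Let_def scaleV_axis mons mons1 coord_def
          axis_plus del: vector_transpose_matrix mon_val.simps,
        simp_all add: vec_eq_iff forall_3 vM tr M1_def M2_def M3_def M4_def third axis_def conjK_0
          mult_ac del: vector_transpose_matrix mon_val.simps)
qed

section \<open>The finite computations\<close>

text \<open>The two fixed vectors $(e_1)_0$ and $(e_1)_1$ carry no scalar variable; \<open>z\<close> runs through the
  multiples of all coordinate vectors.\<close>

definition jacobi_terms :: "nat \<Rightarrow> f3 \<Rightarrow> bool" where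
  "jacobi_terms s j = (let x = Term 0 F0 [] one_mon; y = Term 1 F0 [] one_mon;
       z = Term s j [False] one_mon in
     cancels 99 (terms_bracket (term_bracket x y) [z] @ terms_bracket (term_bracket y z) [x] @
       terms_bracket (term_bracket z x) [y]))"

lemma check_jacobi: "\<forall>s\<in>set [0..<13]. \<forall>j\<in>set [F0, F1, F2]. jacobi_terms s j"
  by code_simp

lemma jacobi_base:
  fixes z :: "'f::field V"
  defines "x \<equiv> coord 0 F0 1" and "y \<equiv> coord 1 F0 1"
  shows "product (product x y) z + product (product y z) x + product (product z x) y = 0"
proof (induction z rule: V_induct)
  case (1 u v)
  have "product (product x y) (u + v) + product (product y (u + v)) x + product (product (u + v) x) y =
      (product (product x y) u + product (product y u) x + product (product u x) y) +
      (product (product x y) v + product (product y v) x + product (product v x) y)"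
    by (simp only: product_add add_ac)
  with 1 show ?case by simp
next
  case (2 s j c)
  let ?x = "Term 0 F0 [] one_mon" and ?y = "Term 1 F0 [] one_mon" and ?z = "Term s j [False] one_mon"
  have j: "j \<in> set [F0, F1, F2]" by (cases j) simp_all
  from 2 have "s \<in> set [0..<13]" by simp
  with j have "jacobi_terms s j" using check_jacobi by blast
  then have sum0: "sem [c] (terms_bracket (term_bracket ?x ?y) [?z]) +
      (sem [c] (terms_bracket (term_bracket ?y ?z) [?x]) +
       sem [c] (terms_bracket (term_bracket ?z ?x) [?y])) = 0"
    unfolding jacobi_terms_def Let_def sem_simps(3)[symmetric] by (rule cancels_sound(1))
  have wf: "wf_term (length []) ?x" "wf_term (length []) ?y" "wf_term (length [c]) ?z"
    using 2 by simp_all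
  have one: "sem1 [] (Term t i [] one_mon) = coord t i 1" for t i by simp
  have sem: "sem (xs @ ys @ zs) (terms_bracket (term_bracket a b) [d]) =
      product (product (sem1 xs a) (sem1 ys b)) (sem1 zs d)"
    if a: "wf_term (length xs) a" and b: "wf_term (length ys) b" and d: "wf_term (length zs) d"
    for xs ys zs and a b d
  proof -
    have "list_all (wf_term (length (xs @ ys))) (term_bracket a b)"
      using wf_term_bracket[OF a b] by (simp only: length_append)
    moreover have "list_all (wf_term (length zs)) [d]" using d by simp
    ultimately have "sem ((xs @ ys) @ zs) (terms_bracket (term_bracket a b) [d]) =
        product (sem (xs @ ys) (term_bracket a b)) (sem zs [d])"
      by (rule terms_bracket_sem)
    then show ?thesis
      unfolding term_bracket_sem[OF a b] by simp
  qed
  show ?case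
    using sum0 sem[OF wf(1,2,3)] sem[OF wf(2,3,1)] sem[OF wf(3,1,2)]
    unfolding one sem1_unit x_def y_def append_Nil append_Nil2 by (simp only: add.assoc)
qed

lemma check_antisym: "for_all_pairs antisymmetric_terms"
  by code_simp

lemma check_a: "for_all_pairs (invariant_terms blocks_a (Mon 0 True F0))"
  by code_simp

lemma check_b: "for_all_pairs (invariant_terms blocks_b (Mon 0 True F0))"
  by code_simp

lemma check_c: "for_all_pairs (invariant_terms blocks_c (Mon 2 False F0))"
  by code_simp

lemma check_d: "for_all_pairs (invariant_terms blocks_d (Mon 0 True F0))"
  by code_simp

lemma check_e: "for_all_pairs (invariant_terms blocks_e (Mon 0 True F0))"
  by code_simp

section \<open>Words in the generators\<close>

definition generators :: "('f::field V \<Rightarrow> 'f V) set" where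
  "generators = {gen_a, gen_b, gen_c, gen_d, gen_e}"

text \<open>Inverses are left out: relations and products are moved forward along generators only.\<close>

inductive_set words :: "('f::field V \<Rightarrow> 'f V) set" where
  word_id: "id \<in> words"
| word_step: "g \<in> generators \<Longrightarrow> h \<in> words \<Longrightarrow> g \<circ> h \<in> words"

lemma word_comp: "g \<in> words \<Longrightarrow> h \<in> words \<Longrightarrow> g \<circ> h \<in> words"
  by (induction rule: words.induct) (auto simp: comp_assoc intro: word_step)

lemma word_gen: "g \<in> generators \<Longrightarrow> g \<in> words"
  using word_step[OF _ word_id] by auto

lemma words_generators:
  "gen_a \<in> words" "gen_b \<in> words" "gen_c \<in> words" "gen_d \<in> words" "gen_e \<in> words"
  by (auto intro!: word_gen simp: generators_def)

text \<open>These are the powers of $a$ and the conjugates of $d$ and $e$ under them. The latter act on every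
  summand separately.\<close>

definition rot_a :: "13 \<Rightarrow> 'f::field V \<Rightarrow> 'f V" where
  "rot_a n v = (\<chi> s. v $ (s - n))"

definition shift_d :: "13 \<Rightarrow> 'f::field V \<Rightarrow> 'f V" where
  "shift_d n v = (\<chi> s. delta (s + n) *s v $ s)"

definition shift_e :: "13 \<Rightarrow> 'f::field V \<Rightarrow> 'f V" where
  "shift_e n v = (\<chi> s. block_e (s + n) (v $ s))"

lemma word_rot_a: "rot_a n \<in> words"
proof -
  obtain k where k: "n = of_nat k" using ex_point[of n] by (elim exE conjE)
  have "rot_a (of_nat k) \<in> (words :: ('a V \<Rightarrow> 'a V) set)" for k
  proof (induction k)
    case 0
    have "rot_a 0 = (id :: 'a V \<Rightarrow> 'a V)" by (simp add: rot_a_def fun_eq_iff)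
    then show ?case by (simp only: of_nat_0 word_id)
  next
    case (Suc k)
    have "rot_a (of_nat (Suc k)) = (gen_a \<circ> rot_a (of_nat k) :: 'a V \<Rightarrow> 'a V)"
      by (simp add: fun_eq_iff vec_eq_iff gen_a_component rot_a_def algebra_simps)
    then show ?case by (simp only: word_comp words_generators Suc)
  qed
  then show ?thesis by (simp only: k)
qed

lemma word_shift_d: "shift_d n \<in> (words :: ('f::field V \<Rightarrow> 'f V) set)"
proof -
  have "shift_d n = (rot_a (- n) \<circ> gen_d \<circ> rot_a n :: 'f V \<Rightarrow> 'f V)"
    by (simp add: fun_eq_iff vec_eq_iff gen_d_component rot_a_def shift_d_def)
  then show ?thesis by (simp only: word_comp word_rot_a words_generators)
qed

lemma word_shift_e: "shift_e n \<in> (words :: ('f::field V \<Rightarrow> 'f V) set)"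
proof -
  have "shift_e n = (rot_a (- n) \<circ> gen_e \<circ> rot_a n :: 'f V \<Rightarrow> 'f V)"
    by (simp add: fun_eq_iff vec_eq_iff[where 'b = 13] gen_e_component rot_a_def shift_e_def)
  then show ?thesis by (simp only: word_comp word_rot_a words_generators)
qed

lemma point_simps:
  "(13 :: 13) = 0" "(14 :: 13) = 1" "(15 :: 13) = 2" "(16 :: 13) = 3" "(17 :: 13) = 4"
  "(18 :: 13) = 5" "(19 :: 13) = 6" "(20 :: 13) = 7" "(21 :: 13) = 8" "(22 :: 13) = 9"
  "(23 :: 13) = 10" "(24 :: 13) = 11" "(27 :: 13) = 1" "(30 :: 13) = 4" "(33 :: 13) = 7" "(36 :: 13) = 10"
proof -
  show "(13 :: 13) = 0" "(27 :: 13) = 1" by (rule thirteen_simps)+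
  have mod: "numeral n = (of_nat (numeral n mod 13) :: 13)" for n
    by (simp only: of_nat_mod13 of_nat_numeral)
  show "(14 :: 13) = 1" "(15 :: 13) = 2" "(16 :: 13) = 3" "(17 :: 13) = 4" "(18 :: 13) = 5"
    "(19 :: 13) = 6" "(20 :: 13) = 7" "(21 :: 13) = 8" "(22 :: 13) = 9" "(23 :: 13) = 10"
    "(24 :: 13) = 11" "(30 :: 13) = 4" "(33 :: 13) = 7" "(36 :: 13) = 10"
    by (subst mod, simp)+
qed

lemma rot_a_axis: "rot_a n (axis t v) = axis (t + n) v"
  by (auto simp: rot_a_def vec_eq_iff[where 'b = 13] axis_def algebra_simps)

lemma block_e_0: "block_e t 0 = 0"
  using block_e_eqs(1) by (metis add_cancel_right_right)

lemma shift_e_axis: "shift_e n (axis t v) = axis t (block_e (t + n) v)"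
  by (auto simp: shift_e_def vec_eq_iff[where 'b = 13] axis_def block_e_0)

lemma shift_d_axis: "shift_d n (axis t v) = axis t (delta (t + n) *s v)"
  by (auto simp: shift_d_def vec_eq_iff[where 'b = 13] axis_def)

lemma gen_b_axis: "gen_b (axis t v) = axis (3 * t) (row3 (\<omega> * v$1) (\<omega>_bar * v$2) (\<omega>_bar * v$3))"
  unfolding gen_b_def by (rule from_summands_single) (simp add: vec_eq_iff axis_def forall_3)

lemma gen_c_involution:
  fixes v :: "'f::field V"
  assumes "(3 :: 'f) \<noteq> 0"
  shows "gen_c (gen_c v) = v"
  unfolding vec_eq_iff[of "gen_c (gen_c v)"] forall_13
  unfolding gen_c_eq[of "gen_c v"]
  by (simp add: gen_c_eq[of v] conjv_vM vector_matrix_mul_assoc M_inv[OF assms] conjv_conjv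
       del: vector_transpose_matrix)
     (simp add: vec_eq_iff forall_3 conjK_minus conjK_hom omega_cancel)

section \<open>Transitivity on pairs of summands\<close>

lemma row3_eta: "row3 (v$1) (v$2) (v$3) = v"
  by (simp add: vec_eq_iff forall_3)

text \<open>Three kinds of elements move the pair $(e_1)_0, (e_1)_1$ around. Conjugates of $d$ multiply the two
  vectors by independent powers of \<open>\<omega>\<close>, which yields all scalars from $K$. Conjugates of $e$ permute
  the coordinates of $V_0$ and $V_1$ cyclically, which yields all of $V_0 \times V_1$. Finally $a$, $b$ and
  $c$ move $(V_0, V_1)$ to every other pair: $a$ makes only the difference $s - t$ matter, $b$
  multiplies it by $3$, and $c$ fuses the four orbits of differences under multiplication by $3$.\<close>

lemma two_transitive:
  fixes P :: "'f::field V \<Rightarrow> 'f V \<Rightarrow> bool"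
  assumes three: "(3 :: 'f) \<noteq> 0"
    and add: "\<And>x x' y. P x y \<Longrightarrow> P x' y \<Longrightarrow> P (x + x') y"
      "\<And>x y y'. P x y \<Longrightarrow> P x y' \<Longrightarrow> P x (y + y')"
    and scale: "\<And>r x y. P x y \<Longrightarrow> P (scaleV r x) y" "\<And>r x y. P x y \<Longrightarrow> P x (scaleV r y)"
    and closed: "\<And>g x y. g \<in> generators \<Longrightarrow> P x y \<Longrightarrow> P (g x) (g y)"
    and base: "P (axis 0 (row3 1 0 0)) (axis 1 (row3 1 0 0))"
    and "t \<noteq> s"
  shows "P (axis t u) (axis s v)"
proof -
  have words: "P (g x) (g y)" if "g \<in> words" "P x y" for g x y
    using that by (induction) (simp_all add: closed)
  have basis: "axis t (row3 x 0 0) = scaleV (coeff_1 x) (axis t (row3 1 0 0)) +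
      scaleV (coeff_omega x) (axis t (row3 \<omega> 0 0))" for t :: 13 and x :: "'f K"
  proof -
    have "row3 x 0 0 = of_base (coeff_1 x) *s row3 1 0 0 + of_base (coeff_omega x) *s row3 \<omega> 0 0"
      by (subst K_decomp) (simp add: vec_eq_iff forall_3)
    then show ?thesis by (simp only: scaleV_axis axis_plus)
  qed
  have delta: "delta 0 = (1 :: 'f K)" "delta 1 = (\<omega> :: 'f K)" "delta 2 = (1 :: 'f K)"
    by (simp_all add: delta_def)
  have smult: "\<omega> *s row3 1 0 0 = row3 \<omega> 0 0" "\<omega> *s row3 \<omega> 0 0 = row3 (\<omega> * \<omega>) 0 0"
    "1 *s w = w" for w :: "'f K^3"
    by (simp_all add: vec_eq_iff forall_3)
  \<comment> \<open>The conjugate of $d$ used here fixes $V_0$ pointwise and multiplies $V_1$ by \<open>\<omega>\<close>; next, conversely.\<close>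
  have P1: "P (axis 0 (row3 1 0 0)) (axis 1 (row3 y 0 0))" for y
  proof -
    have "P (axis 0 (row3 1 0 0)) (axis 1 (row3 \<omega> 0 0))"
      using words[OF word_shift_d[of 0] base] by (simp add: shift_d_axis delta smult)
    then show ?thesis
      by (subst basis) (intro add scale base)
  qed
  have P2: "P (axis 0 (row3 x 0 0)) (axis 1 (row3 y 0 0))" for x y
  proof -
    have "P (axis 0 (row3 \<omega> 0 0)) (axis 1 (row3 y 0 0))"
      using words[OF word_shift_d[of 1] P1[of y]] by (simp add: shift_d_axis delta smult)
    then show ?thesis
      by (subst basis) (intro add scale P1)
  qed
  have e0: "block_e 0 w = w" and e1: "block_e 1 w = row3 (w$3) (w$1) (w$2)" for w :: "'f K^3"
    by (simp_all add: block_e_def row3_eta)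
  have e3: "block_e t (block_e t (block_e t w)) = w" for t and w :: "'f K^3"
    using block_e_eqs(3) by blast
  have split: "axis t w = axis t (row3 (w$1) 0 0) + (axis t (row3 0 (w$2) 0) + axis t (row3 0 0 (w$3)))"
    for t :: 13 and w :: "'f K^3"
    by (simp add: axis_plus) (simp add: vec_eq_iff forall_3 axis_def)
  \<comment> \<open>On $V_0$ the map $e$ is the identity and on $V_1$ it is a cyclic permutation of the coordinates.\<close>
  have P3: "P (axis 0 (row3 x 0 0)) (axis 1 w)" for x w
  proof -
    have cyc: "P (axis 0 (row3 x 0 0)) (axis 1 (row3 (w$3) (w$1) (w$2)))"
      if "P (axis 0 (row3 x 0 0)) (axis 1 w)" for w
      using words[OF word_shift_e[of 0] that] by (simp add: shift_e_axis e0 e1)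
    have "P (axis 0 (row3 x 0 0)) (axis 1 (row3 0 y 0))" for y
      using cyc[OF P2[of x y]] by simp
    then show ?thesis
      using cyc[of "row3 0 (w$3) 0"] by (subst split) (intro add P2, simp_all)
  qed
  \<comment> \<open>The conjugate of $e$ that permutes the coordinates of $V_0$ acts bijectively on $V_1$.\<close>
  have S01: "P (axis 0 u) (axis 1 w)" for u w
  proof -
    have cyc: "\<And>w. P (axis 0 (row3 (u$3) (u$1) (u$2))) (axis 1 w)"
      if "\<And>w. P (axis 0 u) (axis 1 w)" for u
    proof -
      fix w
      show "P (axis 0 (row3 (u$3) (u$1) (u$2))) (axis 1 w)"
        using words[OF word_shift_e[of 1] that[of "block_e 2 (block_e 2 w)"]]
        by (simp add: shift_e_axis e1 e3)
    qed
    have "P (axis 0 (row3 0 x 0)) (axis 1 w)" for x w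
      using cyc[OF P3[of x]] by simp
    then show ?thesis
      using cyc[of "row3 0 (u$3) 0"] by (subst split) (intro add P3, simp_all)
  qed
  define S where "S t s \<longleftrightarrow> (\<forall>u w. P (axis t u) (axis s w))" for t s
  have S_a: "S (t + n) (s + n)" if "S t s" for t s n
    using words[OF word_rot_a[of n]] that unfolding S_def by (metis rot_a_axis)
  have S_b: "S (3 * t) (3 * s)" if "S t s" for t s
    unfolding S_def
  proof (intro allI)
    fix u w :: "'f K^3"
    have "gen_b (axis t (row3 (\<omega>_bar * u$1) (\<omega> * u$2) (\<omega> * u$3))) = axis (3 * t) u"
      for t and u :: "'f K^3"
      by (simp add: gen_b_axis omega_cancel row3_eta)
    then show "P (axis (3 * t) u) (axis (3 * s) w)"
      using words[OF words_generators(2)] that unfolding S_def by metis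
  qed
  \<comment> \<open>Preimages under the involution $c$ are again images under $c$.\<close>
  have S_c: "S t' s'" if "S t s" and t: "\<And>u :: 'f K^3. \<exists>w. gen_c (axis t' u) = axis t w"
    and s: "\<And>u :: 'f K^3. \<exists>w. gen_c (axis s' u) = axis s w" for t s t' s'
    unfolding S_def
  proof (intro allI)
    fix u w :: "'f K^3"
    obtain u' w' where "gen_c (axis t' u) = axis t u'" "gen_c (axis s' w) = axis s w'"
      using t s by blast
    moreover have "P (axis t u') (axis s w')" using that(1) by (simp add: S_def)
    ultimately show "P (axis t' u) (axis s' w)"
      using words[OF words_generators(3)] gen_c_involution[OF three] by metis
  qed
  have c: "\<exists>w'. gen_c (axis 1 w) = axis 1 w'" "\<exists>w'. gen_c (axis 2 w) = axis 2 w'"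
    "\<exists>w'. gen_c (axis 6 w) = axis 5 w'" "\<exists>w'. gen_c (axis 10 w) = axis 4 w'" for w :: "'f K^3"
    by (auto simp: c_block Let_def)
  define T where "T d \<longleftrightarrow> (\<forall>t. S t (t + d))" for d
  have T: "T d" if "S t (t + d)" for t d
    unfolding T_def
  proof
    fix t'
    show "S t' (t' + d)" using S_a[OF that, of "t' - t"] by (simp add: algebra_simps)
  qed
  have T3: "T (3 * d)" if "T d" for d
  proof -
    have "S 0 (0 + d)" using that by (simp only: T_def)
    from S_b[OF this] show ?thesis using T[of 0 "3 * d"] by simp
  qed
  have "S 0 (0 + 1)" using S01 by (simp add: S_def)
  then have T1: "T 1" by (rule T)
  from T3[OF T1] have T_3: "T 3" by simp
  from T3[OF T_3] have T_9: "T 9" by simp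
  \<comment> \<open>The map $c$ sends $(V_2, V_5)$ to $(V_2, V_6)$, $(V_1, V_5)$ to $(V_1, V_6)$ and $(V_2, V_4)$ to $(V_2, V_{10})$.\<close>
  have "S 2 5" using spec[OF T_3[unfolded T_def], of 2] by simp
  from S_c[OF this c(2) c(3)] have T_4: "T 4" using T[of 2 4] by simp
  from T3[OF T_4] have T_12: "T 12" by simp
  from T3[OF T_12] have T_10: "T 10" by (simp add: point_simps)
  have "S 1 5" using spec[OF T_4[unfolded T_def], of 1] by simp
  from S_c[OF this c(1) c(3)] have T_5: "T 5" using T[of 1 5] by simp
  from T3[OF T_5] have T_2: "T 2" by (simp add: point_simps)
  from T3[OF T_2] have T_6: "T 6" by simp
  have "S 2 4" using spec[OF T_2[unfolded T_def], of 2] by simp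
  from S_c[OF this c(2) c(4)] have T_8: "T 8" using T[of 2 8] by simp
  from T3[OF T_8] have T_11: "T 11" by (simp add: point_simps)
  from T3[OF T_11] have T_7: "T 7" by (simp add: point_simps)
  have "\<forall>d. d \<noteq> 0 \<longrightarrow> T d"
    unfolding forall_13
    by (simp add: T1 T_2 T_3 T_4 T_5 T_6 T_7 T_8 T_9 T_10 T_11 T_12)
  then have "T (s - t)" using \<open>t \<noteq> s\<close> by simp
  then have "S t (t + (s - t))" unfolding T_def ..
  then show ?thesis by (simp add: S_def)
qed

section \<open>The Jacobi identity\<close>

lemma axis_coord: "coord t F0 1 = axis (of_nat t) (row3 1 0 0)"
proof -
  have "row3 1 0 0 = (axis 1 1 :: 'a K^3)" by (simp add: vec_eq_iff forall_3 axis_def)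
  then show "coord t F0 1 = axis (of_nat t) (row3 1 0 0 :: 'a K^3)"
    by (simp add: coord_def)
qed

lemma V_induct_axis:
  fixes P :: "'f::field V \<Rightarrow> bool"
  assumes "\<And>u v. P u \<Longrightarrow> P v \<Longrightarrow> P (u + v)" and "\<And>t v. P (axis t v)"
  shows "P v"
  by (rule V_induct[where P = P]) (simp_all add: assms coord_def)

lemma product_same: "product (axis t u) (axis t v) = 0"
proof -
  obtain n where n: "n < 13" "t = of_nat n" using ex_point[of t] by (elim exE conjE)
  have split: "axis t w = coord n F0 (w $ 1) + coord n F1 (w $ 2) + coord n F2 (w $ 3)" for w :: "'a K^3"
    by (simp add: coord_def n axis_plus) (simp add: vec_eq_iff forall_3 axis_def)
  have "diff13 n n = 0" by (induction n) simp_all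
  then have "product (coord n i x) (coord n j y) = 0" for i j and x y :: "'a K"
    using n by (simp add: product_coord rows_def row_table_def)
  then show ?thesis
    unfolding split[of u] split[of v] product_add by simp
qed

definition jacobiator :: "'f::field V \<Rightarrow> 'f V \<Rightarrow> 'f V \<Rightarrow> 'f V" where
  "jacobiator x y z =
     product (product x y) z + product (product y z) x + product (product z x) y"

lemma jacobiator_add:
  "jacobiator (x + x') y z = jacobiator x y z + jacobiator x' y z"
  "jacobiator x (y + y') z = jacobiator x y z + jacobiator x y' z"
  "jacobiator x y (z + z') = jacobiator x y z + jacobiator x y z'"
  by (simp_all only: jacobiator_def product_add add_ac)

lemma jacobiator_scaleV:
  "jacobiator (scaleV r x) y z = scaleV r (jacobiator x y z)"
  "jacobiator x (scaleV r y) z = scaleV r (jacobiator x y z)"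
  by (simp_all only: jacobiator_def product_scaleV scaleV_add)

lemma jacobiator_rotate: "jacobiator x y z = jacobiator y z x"
  by (simp only: jacobiator_def add_ac)

text \<open>Transitivity settles the case in which two of the three vectors lie in different summands, as the
  Jacobi expression is invariant under cyclic rotation. Inside a single summand all products vanish.\<close>

lemma jacobi:
  fixes x y z :: "'f::field V"
  assumes three: "(3 :: 'f) \<noteq> 0"
    and invariant: "\<And>g (u :: 'f V) v. g \<in> generators \<Longrightarrow> product (g u) (g v) = g (product u v)"
    and generators: "\<And>g :: 'f V \<Rightarrow> 'f V. g \<in> generators \<Longrightarrow> F_linear g \<and> bij g"
  shows "jacobiator x y z = 0"
proof -
  have distinct: "jacobiator (axis t u) (axis s v) z = 0" if "t \<noteq> s" for t s u v and z :: "'f V"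
  proof -
    have "\<forall>z. jacobiator (axis t u) (axis s v) (z :: 'f V) = 0"
    proof (rule two_transitive[where P = "\<lambda>x y. \<forall>z. jacobiator x y z = 0", OF three])
      fix g :: "'f V \<Rightarrow> 'f V" and x y :: "'f V"
      assume g: "g \<in> generators" and zero: "\<forall>z. jacobiator x y z = 0"
      show "\<forall>z. jacobiator (g x) (g y) z = 0"
      proof
        fix z
        obtain z' where z: "z = g z'" using generators[OF g] by (metis bij_pointE)
        have lin: "F_linear g" using generators[OF g] by simp
        have "jacobiator (g x) (g y) (g z') = g (jacobiator x y z')"
          by (simp only: jacobiator_def invariant[OF g] F_linear_simps[OF lin])
        then show "jacobiator (g x) (g y) z = 0"
          by (simp add: zero z F_linear_simps[OF lin])
      qed
    next
      show "\<forall>z :: 'f V. jacobiator (axis 0 (row3 1 0 0)) (axis 1 (row3 1 0 0)) z = 0"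
        using jacobi_base[where 'f = 'f] by (simp add: jacobiator_def axis_coord)
    qed (use that in \<open>simp_all add: jacobiator_add jacobiator_scaleV scaleV_simps\<close>)
    then show ?thesis ..
  qed
  have axes: "jacobiator (axis t u) (axis s v) (axis q w) = 0" for t s q and u v w :: "'f K^3"
  proof -
    consider "t \<noteq> s" | "s \<noteq> q" | "t = s" "s = q" by blast
    then show ?thesis
    proof cases
      case 3
      then show ?thesis by (simp add: jacobiator_def product_same product_zero)
    qed (use distinct jacobiator_rotate in metis)+
  qed
  have "jacobiator (axis t u) (axis s v) z = 0" for t s u v
    by (induction z rule: V_induct_axis) (simp_all add: jacobiator_add axes)
  then have "jacobiator (axis t u) y z = 0" for t u
    by (induction y rule: V_induct_axis) (simp_all add: jacobiator_add)
  then show ?thesis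
    by (induction x rule: V_induct_axis) (simp_all add: jacobiator_add)
qed

section \<open>Invariant products are determined by one value\<close>

lemma axis_inject: "axis t u = axis t v \<longleftrightarrow> u = v"
  by (auto simp: axis_eq_axis)

lemma rot_a_add: "rot_a n (u + v) = rot_a n u + rot_a n v"
  by (simp add: rot_a_def vec_eq_iff)

lemma K_cancel: "numeral n * x = (0 :: 'f K) \<Longrightarrow> (numeral n :: 'f::field) \<noteq> 0 \<Longrightarrow> x = 0"
  by (cases x) (simp add: numeral_K comp_eqs(6) zero_K_def)

text \<open>The reason is that $1 - \omega$ divides $3 = (1 - \omega)(1 - \overline{\omega})$ in $K$. So a
  component on which some diagonal map acts as the identity on one side of an invariance equation and
  by a nontrivial power of \<open>\<omega>\<close> on the other side must vanish.\<close>

lemma omega_fixed: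
  assumes "(3 :: 'f::field) \<noteq> 0" "\<omega> * x = x \<or> \<omega>_bar * x = (x :: 'f K)"
  shows "x = 0"
proof -
  have "\<omega> * x = x \<and> \<omega>_bar * x = x"
    using assms(2) omega_cancel by metis
  moreover have "x + \<omega> * x + \<omega>_bar * x = 0"
    by (simp add: omega_bar_eq(2) algebra_simps)
  ultimately have "3 * x = 0"
    by (simp add: algebra_simps)
  then show ?thesis using assms(1) by (rule K_cancel)
qed

lemma delta_fixed:
  assumes "(3 :: 'f::field) \<noteq> 0" "delta t *s v = (v :: 'f K^3)" "t \<notin> {0, 2, 8, 12}"
  shows "v = 0"
proof -
  have "delta t = (\<omega> :: 'f K) \<or> delta t = (\<omega>_bar :: 'f K)"
    using assms(3) by (simp add: delta_def)
  then have "v $ k = 0" for k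
    using omega_fixed[OF assms(1), of "v $ k"] assms(2) by (metis vector_smult_component)
  then show ?thesis by (simp add: vec_eq_iff)
qed

locale invariant_product =
  fixes B :: "'f::field V \<Rightarrow> 'f V \<Rightarrow> 'f V"
  assumes two: "(2 :: 'f) \<noteq> 0" and three: "(3 :: 'f) \<noteq> 0"
    and bilinear: "F_bilinear B"
    and invariant: "g \<in> words \<Longrightarrow> B (g u) (g v) = g (B u v)"
begin

lemma B_simps:
  "B (u + u') v = B u v + B u' v" "B u (v + v') = B u v + B u v'"
  "B (scaleV r u) v = scaleV r (B u v)" "B u (scaleV r v) = scaleV r (B u v)"
  "B 0 v = 0" "B u 0 = 0" "B (- u) v = - B u v" "B u (- v) = - B u v"
proof -
  have "F_linear (\<lambda>u. B u v)" "F_linear (\<lambda>v. B u v)" for u v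
    using bilinear by (auto simp: F_bilinear_def)
  note lin = F_linear_simps[OF this(1)] F_linear_simps[OF this(2)]
  show "B (u + u') v = B u v + B u' v" "B u (v + v') = B u v + B u v'"
    "B (scaleV r u) v = scaleV r (B u v)" "B u (scaleV r v) = scaleV r (B u v)"
    "B 0 v = 0" "B u 0 = 0" "B (- u) v = - B u v" "B u (- v) = - B u v"
    by (rule lin)+
qed

lemma B_axis_minus: "B (axis t (- u)) v = - B (axis t u) v" "B u' (axis t (- u)) = - B u' (axis t u)"
proof -
  have "axis t (- u) = - axis t u" by (simp add: vec_eq_iff axis_def)
  then show "B (axis t (- u)) v = - B (axis t u) v" "B u' (axis t (- u)) = - B u' (axis t u)"
    by (simp_all only: B_simps)
qed

definition base_value :: "'f V" where
  "base_value = B (axis 0 (row3 1 0 0)) (axis 1 (row3 1 0 0))"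

lemma delta_values:
  "delta 0 = (1 :: 'f K)" "delta 1 = (\<omega> :: 'f K)" "delta 2 = (1 :: 'f K)" "delta 4 = (\<omega> :: 'f K)"
  by (simp_all add: delta_def)

lemma smult_row3: "c *s row3 x y z = row3 (c * x) (c * y) (c * z :: 'f K)"
  by (simp add: vec_eq_iff forall_3)

lemma fixed_by_shift_d:
  assumes "shift_d n v = v" "s + n \<notin> {0, 2, 8, 12}"
  shows "v $ s = (0 :: 'f K^3)"
proof (rule delta_fixed[OF three _ assms(2)])
  show "delta (s + n) *s v $ s = v $ s"
    using arg_cong[OF assms(1), of "\<lambda>v. v $ s"] by (simp add: shift_d_def)
qed

text \<open>These two conjugates of $d$ fix one of the vectors $(e_1)_0$, $(e_1)_1$ and multiply the other one by
  \<open>\<omega>\<close>; now $1 + \omega + \omega^2 = 0$.\<close>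

lemma shift_d_sum: "base_value + shift_d n base_value + shift_d n (shift_d n base_value) = 0" if "n = 0 \<or> n = 1"
proof -
  have zero: "axis t (row3 1 0 0) + axis t (row3 \<omega> 0 0) + axis t (row3 (\<omega> * \<omega>) 0 0) = (0 :: 'f V)" for t :: 13
  proof -
    have "row3 1 0 0 + row3 \<omega> 0 0 + row3 (\<omega> * \<omega>) 0 0 = (0 :: 'f K^3)"
      using omega_relation[where 'f = 'f] by (simp add: vec_eq_iff forall_3 power2_eq_square add_ac)
    then show ?thesis by (simp only: axis_plus axis_zero)
  qed
  show ?thesis
    using that
  proof
    assume n: "n = 0"
    have "shift_d n base_value = B (axis 0 (row3 1 0 0)) (axis 1 (row3 \<omega> 0 0))"
      by (simp add: base_value_def n invariant[OF word_shift_d, symmetric] shift_d_axis delta_values smult_row3)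
    moreover from this have "shift_d n (shift_d n base_value) =
        B (axis 0 (row3 1 0 0)) (axis 1 (row3 (\<omega> * \<omega>) 0 0))"
      by (simp add: n invariant[OF word_shift_d, symmetric] shift_d_axis delta_values smult_row3)
    ultimately show ?thesis
      unfolding base_value_def by (simp only: B_simps(2)[symmetric] zero B_simps(6))
  next
    assume n: "n = 1"
    have "shift_d n base_value = B (axis 0 (row3 \<omega> 0 0)) (axis 1 (row3 1 0 0))"
      by (simp add: base_value_def n invariant[OF word_shift_d, symmetric] shift_d_axis delta_values smult_row3)
    moreover from this have "shift_d n (shift_d n base_value) =
        B (axis 0 (row3 (\<omega> * \<omega>) 0 0)) (axis 1 (row3 1 0 0))"
      by (simp add: n invariant[OF word_shift_d, symmetric] shift_d_axis delta_values smult_row3)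
    ultimately show ?thesis
      unfolding base_value_def by (simp only: B_simps(1)[symmetric] zero B_simps(5))
  qed
qed

text \<open>The conjugate of $d$ by \<open>rot_a 1\<close> acts trivially exactly on the four summands of the line
  $\{0,1,3,9\}$. In particular it fixes $(e_1)_0$ and $(e_1)_1$, and its fixed vectors have their
  support on that line. The coordinates at $0$ and $1$ are excluded by \<open>shift_d_sum\<close>, because the
  diagonal map in question is trivial there.\<close>

lemma base_value_support: "base_value = axis 3 (base_value $ 3) + axis 9 (base_value $ 9)"
proof -
  have "shift_d 12 base_value = base_value"
    unfolding base_value_def
    by (simp add: invariant[OF word_shift_d, symmetric] shift_d_axis delta_def point_simps)
  note off = fixed_by_shift_d[OF this]
  have "base_value $ n = 0" if n: "n = 0 \<or> n = 1" for n
  proof -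
    have "delta (n + n) = (1 :: 'f K)" using n delta_values by auto
    then have "base_value $ n + base_value $ n + base_value $ n = 0"
      using arg_cong[OF shift_d_sum[OF n], of "\<lambda>v. v $ n"] by (simp add: shift_d_def)
    then have "base_value $ n $ k + base_value $ n $ k + base_value $ n $ k = 0" for k
      by (metis vector_add_component zero_index)
    then have "3 * base_value $ n $ k = 0" for k
      by (simp add: algebra_simps)
    then show ?thesis
      using K_cancel[OF _ three] by (simp add: vec_eq_iff)
  qed
  then have "base_value $ 0 = 0" "base_value $ 1 = 0" by auto
  moreover have "base_value $ 2 = 0" "base_value $ 4 = 0" "base_value $ 5 = 0" "base_value $ 6 = 0" "base_value $ 7 = 0" "base_value $ 8 = 0"
    "base_value $ 10 = 0" "base_value $ 11 = 0" "base_value $ 12 = 0"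
    by (rule off, simp add: point_simps)+
  ultimately show ?thesis
    unfolding vec_eq_iff[where 'b = 13] forall_13 by (simp add: axis_def)
qed

text \<open>A conjugate of $e$ fixes $(e_1)_0$ and $(e_1)_1$. Its fixed vectors in $V_3 \oplus V_9$ are
  $x(1,\omega,\omega)_3 + y(1,\overline{\omega},\overline{\omega})_9$ with $x, y$ in $K$. The map $c$
  negates $(e_1)_0$ and $(e_1)_1$ and interchanges $V_3$ and $V_9$, so
  $y = -\omega x$. It also maps $(V_3, V_4)$, a translate of $(V_0, V_1)$, to the translate
  $(V_9, V_{10})$, and comparing the components in $V_{12}$ gives $\overline{y} = -\omega x$. Hence
  $\overline{y} = y$, and $y$ lies in the base field.\<close>

lemma base_value_shape:
  obtains r where
    "base_value = scaleV r (axis 3 (row3 \<omega>_bar 1 1) - axis 9 (row3 1 \<omega>_bar \<omega>_bar))"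
proof -
  have fixed: "shift_e 12 base_value = base_value"
    unfolding base_value_def
    by (simp add: invariant[OF word_shift_e, symmetric] shift_e_axis block_e_def point_simps)
  have "block_e (s + 12) (base_value $ s) = base_value $ s" for s
    using arg_cong[OF fixed, of "\<lambda>v. v $ s"] by (simp add: shift_e_def)
  from this[of 3] this[of 9] have e: "block_e 2 (base_value $ 3) = base_value $ 3" "block_e 8 (base_value $ 9) = base_value $ 9"
    by (simp_all add: point_simps)
  define x y where "x = base_value $ 3 $ 1" and "y = base_value $ 9 $ 1"
  have "base_value $ 3 $ 3 = \<omega> * x" "base_value $ 3 $ 2 = \<omega> * x" "base_value $ 9 $ 2 = \<omega>_bar * y" "base_value $ 9 $ 3 = \<omega>_bar * y"
    using arg_cong[OF e(1), of "\<lambda>v. v $ 2"] arg_cong[OF e(1), of "\<lambda>v. v $ 3"]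
      arg_cong[OF e(2), of "\<lambda>v. v $ 2"] arg_cong[OF e(2), of "\<lambda>v. v $ 3"]
    by (simp_all add: block_e_def x_def y_def)
  then have v3: "base_value $ 3 = row3 x (\<omega> * x) (\<omega> * x)"
    and v9: "base_value $ 9 = row3 y (\<omega>_bar * y) (\<omega>_bar * y)"
    by (simp_all add: vec_eq_iff forall_3 x_def y_def)
  have c_add: "gen_c (u + v) = gen_c u + (gen_c v :: 'f V)" for u v
    using F_linear_simps(1)[OF lin_c] .
  have "gen_c base_value = base_value"
    unfolding base_value_def
    by (subst invariant[OF words_generators(3), symmetric])
       (simp add: c_block Let_def conjK_01 conjK_0 B_axis_minus)
  moreover have "gen_c base_value $ 9 $ 1 = - (\<omega> * x)"
    by (subst base_value_support) (simp add: c_add c_block Let_def v3, simp add: axis_def)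
  ultimately have y: "y = - (\<omega> * x)" by (simp add: y_def)
  have "gen_c (rot_a 3 base_value) = - rot_a 9 (shift_d 1 base_value)"
  proof -
    have "gen_c (rot_a 3 base_value) = B (axis 9 (- row3 \<omega> 0 0)) (axis 10 (row3 1 0 0))"
      unfolding base_value_def
      by (simp add: invariant[OF word_rot_a, symmetric] invariant[OF words_generators(3), symmetric]
          rot_a_axis c_block Let_def conjK_01 conjK_0)
    moreover have "rot_a 9 (shift_d 1 base_value) = B (axis 9 (row3 \<omega> 0 0)) (axis 10 (row3 1 0 0))"
      unfolding base_value_def
      by (simp add: invariant[OF word_rot_a, symmetric] invariant[OF word_shift_d, symmetric]
          rot_a_axis shift_d_axis delta_values smult_row3)
    ultimately show ?thesis by (simp add: B_axis_minus)
  qed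
  moreover have "gen_c (rot_a 3 base_value) $ 12 $ 1 = conjK y"
  proof -
    have "rot_a 3 base_value = axis 6 (base_value $ 3) + axis 12 (base_value $ 9)"
      by (subst base_value_support) (simp add: rot_a_add rot_a_axis)
    then show ?thesis
      by (simp add: c_add c_block Let_def v9, simp add: axis_def)
  qed
  moreover have "rot_a 9 (shift_d 1 base_value) $ 12 $ 1 = \<omega> * x"
    by (simp add: rot_a_def shift_d_def delta_values x_def)
  ultimately have "conjK y = y" using y by simp
  then obtain r where r: "y = of_base r"
    by (cases y) (auto simp: conjK_mkK of_base_def)
  have "\<omega> * x = of_base (- r)"
    using y r by (simp add: of_base_hom)
  moreover from this have "\<omega>_bar * (\<omega> * x) = \<omega>_bar * of_base (- r)"
    by simp
  then have "x = \<omega>_bar * of_base (- r)"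
    by (simp only: omega_cancel)
  ultimately have "base_value = scaleV (- r) (axis 3 (row3 \<omega>_bar 1 1) - axis 9 (row3 1 \<omega>_bar \<omega>_bar))"
    by (subst base_value_support)
       (simp add: scaleV_simps(3) scaleV_axis v3 v9 r smult_row3 of_base_hom mult.commute,
        simp add: vec_eq_iff axis_def forall_3)
  then show ?thesis by (rule that)
qed

text \<open>Two conjugates of $d$ that fix $V_0$ pointwise force $[V_0, V_0]$ into $V_0$, and one that multiplies
  $V_0$ by \<open>\<omega>\<close> makes the product conjugate-linear in both arguments. The diagonal map
  $(1, \omega, \overline{\omega})$ then puts $[e_1, e_1]$, $[e_2, e_3]$ and $[e_3, e_2]$ into $K e_1$. The
  first one is negated by the transfer of $c$ from $V_1$ to $V_0$, which is where $2 \neq 0$ is used; the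
  other two are killed by $b$. A cyclic permutation of the coordinates reaches the remaining pairs.\<close>

lemma diagonal_zero: "B (axis t u) (axis t v) = 0"
proof -
  define b where "b u v = B (axis 0 u) (axis 0 v) $ 0" for u v
  have fixed: "shift_d n (B (axis 0 u) (axis 0 v)) = B (axis 0 u) (axis 0 v)" if "n = 0 \<or> n = 2" for n u v
    using that by (auto simp: invariant[OF word_shift_d, symmetric] shift_d_axis delta_values)
  have off: "B (axis 0 u) (axis 0 v) $ s = 0" if "s \<noteq> 0" for s u v
  proof -
    have "\<forall>s. s \<noteq> 0 \<longrightarrow> s + 0 \<notin> {0, 2, 8, 12} \<or> s + 2 \<notin> {0, 2, 8, 12 :: 13}"
      unfolding forall_13 by (simp add: point_simps)
    with that show ?thesis
      using fixed_by_shift_d[OF fixed[of 0 u v]] fixed_by_shift_d[OF fixed[of 2 u v]] by blast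
  qed
  have B_b: "B (axis 0 u) (axis 0 v) = axis 0 (b u v)" for u v
  proof -
    have "B (axis 0 u) (axis 0 v) $ s = axis 0 (b u v) $ s" for s
      by (cases "s = 0") (simp_all add: b_def off, simp_all add: axis_def)
    then show ?thesis unfolding vec_eq_iff[where 'b = 13] by blast
  qed
  have b_add: "b (u + u') v = b u v + b u' v" "b u (v + v') = b u v + b u v'" for u u' v v'
    by (simp_all add: b_def B_simps flip: axis_plus)
  have b_scale: "b (of_base r *s u) v = of_base r *s b u v" "b u (of_base r *s v) = of_base r *s b u v" for r u v
    by (simp_all only: b_def B_simps flip: scaleV_axis) (simp_all add: scaleV_def)
  have b_zero: "b 0 v = 0" "b u 0 = 0" for u v
    by (simp_all add: b_def axis_zero B_simps)
  have b_shift_e: "b (block_e n u) (block_e n v) = block_e n (b u v)" for n u v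
  proof -
    have "B (shift_e n (axis 0 u)) (shift_e n (axis 0 v)) = shift_e n (axis 0 (b u v))"
      by (simp only: invariant[OF word_shift_e] B_b)
    then show ?thesis by (simp add: shift_e_axis B_b axis_inject)
  qed
  have b_omega2: "b (\<omega> *s u) (\<omega> *s v) = \<omega> *s b u v" for u v
  proof -
    have "B (shift_d 1 (axis 0 u)) (shift_d 1 (axis 0 v)) = shift_d 1 (axis 0 (b u v))"
      by (simp only: invariant[OF word_shift_d] B_b)
    then show ?thesis by (simp add: shift_d_axis B_b axis_inject delta_values)
  qed
  have omega3: "\<omega> * (\<omega> * (\<omega> * x)) = (x :: 'f K)" and omega_sum: "\<omega> * (\<omega> * x) = - (x + \<omega> * x)" for x
    by (cases x; simp add: omega_def comp_eqs)+
  have omega_sum_v: "\<omega> *s (\<omega> *s u) = - (u + \<omega> *s u)" for u :: "'f K^3"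
    by (simp add: vec_eq_iff omega_sum)
  have b_minus: "b (- u) v = - b u v" "b u (- v) = - b u v" for u v
    using b_add(1)[of u "- u" v] b_add(2)[of u v "- v"] by (simp_all add: b_zero add_eq_0_iff)
  have b_omega: "b (\<omega> *s u) v = \<omega> *s (\<omega> *s b u v)" for u v
  proof -
    have "b (\<omega> *s (\<omega> *s u)) (\<omega> *s (\<omega> *s v)) = \<omega> *s (\<omega> *s b u v)"
      by (simp only: b_omega2)
    then have eq1: "b u v + b u (\<omega> *s v) + b (\<omega> *s u) v + \<omega> *s b u v = \<omega> *s (\<omega> *s b u v)"
      unfolding omega_sum_v[of u] omega_sum_v[of v] b_minus b_add b_omega2 by (simp add: algebra_simps)
    have "b (\<omega> *s (\<omega> *s u)) (\<omega> *s v) = \<omega> *s b (\<omega> *s u) v"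
      by (simp only: b_omega2)
    then have eq2: "- (b u (\<omega> *s v) + \<omega> *s b u v) = \<omega> *s b (\<omega> *s u) v"
      unfolding omega_sum_v[of u] b_minus b_add b_omega2 by simp
    have "b (\<omega> *s u) v $ k - \<omega> * (\<omega> * b u v $ k) = 0" for k
    proof (rule omega_fixed[OF three], rule disjI1)
      have "b u v $ k + b u (\<omega> *s v) $ k + b (\<omega> *s u) v $ k + \<omega> * b u v $ k = \<omega> * (\<omega> * b u v $ k)"
        using arg_cong[OF eq1, of "\<lambda>v. v $ k"] by simp
      moreover have "b u (\<omega> *s v) $ k = - (\<omega> * b u v $ k) - \<omega> * b (\<omega> *s u) v $ k"
        using arg_cong[OF eq2, of "\<lambda>v. v $ k"] by (simp add: algebra_simps)
      ultimately show "\<omega> * (b (\<omega> *s u) v $ k - \<omega> * (\<omega> * b u v $ k)) =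
          b (\<omega> *s u) v $ k - \<omega> * (\<omega> * b u v $ k)"
        unfolding right_diff_distrib omega3 by (simp add: algebra_simps)
    qed
    then show ?thesis by (simp add: vec_eq_iff)
  qed
  have b_omega': "b u (\<omega> *s v) = \<omega> *s (\<omega> *s b u v)" for u v
  proof -
    have "\<omega> *s (\<omega> *s (\<omega> *s b u (\<omega> *s v))) = \<omega> *s (\<omega> *s b u v)"
      using b_omega[of u "\<omega> *s v"] b_omega2[of u v] by simp
    then show ?thesis by (simp add: vec_eq_iff omega3)
  qed
  have decomp: "x *s u = of_base (coeff_1 x) *s u + of_base (coeff_omega x) *s (\<omega> *s u)"
    for x and u :: "'f K^3"
    by (subst K_decomp[of x]) (simp add: vec_eq_iff distrib_right mult.assoc)
  have conj_decomp: "conjK x *s u = of_base (coeff_1 x) *s u + of_base (coeff_omega x) *s (\<omega> *s (\<omega> *s u))"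
    for x and u :: "'f K^3"
    by (simp add: conjK_def vec_eq_iff distrib_right mult.assoc power2_eq_square)
  have b_semilinear: "b (x *s u) v = conjK x *s b u v" "b u (x *s v) = conjK x *s b u v" for x u v
    unfolding decomp[of x] conj_decomp[of x] by (simp_all only: b_add b_scale b_omega b_omega')
  let ?E1 = "row3 1 0 0 :: 'f K^3" and ?E2 = "row3 0 1 0 :: 'f K^3" and ?E3 = "row3 0 0 1 :: 'f K^3"
  have heisenberg: "w $ 2 = 0 \<and> w $ 3 = 0" if "block_e 12 w = w" for w :: "'f K^3"
    using omega_fixed[OF three, of "w $ 2"] omega_fixed[OF three, of "w $ 3"]
      arg_cong[OF that, of "\<lambda>w. w $ 2"] arg_cong[OF that, of "\<lambda>w. w $ 3"]
    by (simp add: block_e_def)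
  have b11: "b ?E1 ?E1 = 0"
  proof -
    let ?p = "b ?E1 ?E1"
    have "block_e 12 ?p = ?p"
      using b_shift_e[of 12 ?E1 ?E1] by (simp add: block_e_def)
    from heisenberg[OF this] have p: "?p $ 2 = 0" "?p $ 3 = 0" by auto
    let ?g = "rot_a 12 \<circ> gen_c \<circ> rot_a 1 :: 'f V \<Rightarrow> 'f V"
    have g: "?g (axis 0 u) = axis 0 (- row3 (u$1) (u$3) (u$2))" for u
      by (simp add: rot_a_axis c_block Let_def point_simps)
    have "?g \<in> words" by (simp only: word_comp word_rot_a words_generators)
    from invariant[OF this, of "axis 0 ?E1" "axis 0 ?E1"]
    have "axis 0 ?p = (axis 0 (- row3 (?p$1) (?p$3) (?p$2)) :: 'f V)"
      by (simp only: g B_b) (simp add: b_minus B_b)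
    then have "?p = - row3 (?p$1) (?p$3) (?p$2)"
      unfolding axis_inject .
    from arg_cong[OF this, of "\<lambda>w. w $ 1"] have "2 * ?p $ 1 = 0"
      by simp
    then have "?p $ 1 = 0" using two by (rule K_cancel)
    with p show ?thesis by (simp add: vec_eq_iff forall_3)
  qed
  have b23: "b E F = 0" if "block_e 12 E = c *s E" "block_e 12 F = conjK c *s F" "c * conjK c = 1"
    and E: "gen_b (axis 0 E) = axis 0 (\<omega>_bar *s E)" and F: "gen_b (axis 0 F) = axis 0 (\<omega>_bar *s F)" for E F c
  proof -
    let ?q = "b E F"
    have "block_e 12 ?q = ?q"
      using b_shift_e[of 12 E F] that(1-3)
      by (simp add: b_semilinear conjK_hom vec_eq_iff mult.assoc[symmetric] mult.commute)
    from heisenberg[OF this] have q: "?q $ 2 = 0" "?q $ 3 = 0" by auto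
    have "B (gen_b (axis 0 E)) (gen_b (axis 0 F)) = gen_b (axis 0 ?q)"
      by (simp only: invariant[OF words_generators(2)] B_b)
    then have "axis 0 (\<omega> *s (\<omega> *s ?q)) = gen_b (axis 0 ?q)"
      by (simp add: E F B_b b_semilinear conjK_hom)
    then have "\<omega> *s (\<omega> *s ?q) = row3 (\<omega> * ?q$1) (\<omega>_bar * ?q$2) (\<omega>_bar * ?q$3)"
      by (simp only: gen_b_axis mult_zero_right axis_inject)
    from arg_cong[OF this, of "\<lambda>w. w $ 1"] have "\<omega> * (\<omega> * ?q $ 1) = \<omega> * ?q $ 1"
      by simp
    then have "\<omega>_bar * (\<omega> * (\<omega> * ?q $ 1)) = \<omega>_bar * (\<omega> * ?q $ 1)" by simp
    then have "?q $ 1 = 0" unfolding omega_cancel using omega_fixed[OF three] by blast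
    with q show ?thesis by (simp add: vec_eq_iff forall_3)
  qed
  have bar: "\<omega> * \<omega>_bar = (1 :: 'f K)" "\<omega>_bar * \<omega> = (1 :: 'f K)"
    by (simp_all add: omega_def conjK_mkK comp_eqs)
  have E23: "b ?E2 ?E3 = 0" "b ?E3 ?E2 = 0"
    by (rule b23[where c = \<omega>] b23[where c = \<omega>_bar];
        simp add: gen_b_axis block_e_def smult_row3 bar conjK_hom)+
  have cyc: "b (row3 (u$3) (u$1) (u$2)) (row3 (v$3) (v$1) (v$2)) = 0" if "b u v = 0" for u v
    using b_shift_e[of 1 u v] that by (simp add: block_e_def vec_eq_iff forall_3)
  have basis: "b ?E1 ?E1 = 0" "b ?E2 ?E2 = 0" "b ?E3 ?E3 = 0" "b ?E2 ?E3 = 0" "b ?E3 ?E1 = 0"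
    "b ?E1 ?E2 = 0" "b ?E3 ?E2 = 0" "b ?E1 ?E3 = 0" "b ?E2 ?E1 = 0"
  proof -
    have "b ?E2 ?E2 = 0" using cyc[OF b11] by simp
    moreover from cyc[OF this] have "b ?E3 ?E3 = 0" by simp
    moreover have "b ?E3 ?E1 = 0" using cyc[OF E23(1)] by simp
    moreover from cyc[OF this] have "b ?E1 ?E2 = 0" by simp
    moreover have "b ?E1 ?E3 = 0" using cyc[OF E23(2)] by simp
    moreover from cyc[OF this] have "b ?E2 ?E1 = 0" by simp
    ultimately show "b ?E1 ?E1 = 0" "b ?E2 ?E2 = 0" "b ?E3 ?E3 = 0" "b ?E2 ?E3 = 0" "b ?E3 ?E1 = 0"
      "b ?E1 ?E2 = 0" "b ?E3 ?E2 = 0" "b ?E1 ?E3 = 0" "b ?E2 ?E1 = 0"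
      using b11 E23 by simp_all
  qed
  have expand: "u = u$1 *s ?E1 + u$2 *s ?E2 + u$3 *s ?E3" for u :: "'f K^3"
    by (simp add: vec_eq_iff forall_3)
  have b_all: "b u v = 0" for u v
  proof -
    have "b (u$1 *s ?E1 + u$2 *s ?E2 + u$3 *s ?E3) (v$1 *s ?E1 + v$2 *s ?E2 + v$3 *s ?E3) = 0"
      by (simp only: b_add b_semilinear basis) simp
    then show ?thesis by (simp only: expand[symmetric])
  qed
  have "B (axis t u) (axis t v) = B (rot_a t (axis 0 u)) (rot_a t (axis 0 v))"
    by (simp add: rot_a_axis)
  also have "\<dots> = rot_a t (axis 0 (b u v))"
    by (simp only: invariant[OF word_rot_a] B_b)
  finally show ?thesis
    unfolding rot_a_axis by (simp only: b_all axis_zero)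
qed

lemma zero_if_base_value_zero:
  assumes "base_value = 0"
  shows "B u v = 0"
proof -
  have off: "B (axis t u) (axis s v) = 0" if "t \<noteq> s" for t s u v
  proof (rule two_transitive[where P = "\<lambda>x y. B x y = 0", OF three])
    show "B (axis 0 (row3 1 0 0)) (axis 1 (row3 1 0 0)) = 0"
      using assms by (simp add: base_value_def)
    show "B (g x) (g y) = 0" if "g \<in> generators" "B x y = 0" for g x y
    proof -
      have "F_linear g"
        using that(1) lin_a lin_b lin_c lin_d lin_e by (auto simp: generators_def)
      then show ?thesis
        using that(2) by (simp add: invariant[OF word_gen[OF that(1)]] F_linear_simps)
    qed
  qed (use that in \<open>simp_all add: B_simps scaleV_simps\<close>)
  have axes: "B (axis t u) (axis s v) = 0" for t s u v
    using off diagonal_zero by (cases "t = s") simp_all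
  have "B (axis t u) v = 0" for t u
    by (induction v rule: V_induct_axis) (simp_all add: B_simps axes)
  then show ?thesis
    by (induction u rule: V_induct_axis) (simp_all add: B_simps)
qed

end

section \<open>Existence and uniqueness\<close>

lemma product_value:
  "product (axis 0 (row3 1 0 0)) (axis 1 (row3 1 0 0)) =
     axis 3 (row3 \<omega>_bar 1 1) - axis 9 (row3 1 \<omega>_bar \<omega>_bar)"
proof -
  have "product (axis 0 (row3 1 0 0)) (axis 1 (row3 1 0 0)) =
      (product (coord 0 F0 1) (coord 1 F0 1) :: 'a V)"
    by (simp add: axis_coord)
  also have "\<dots> = axis 3 (row3 \<omega>_bar 1 1) - axis 9 (row3 1 \<omega>_bar \<omega>_bar)"
    by (simp add: product_coord rows_def row_table_def conjK_01 reduce13_mod)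
       (simp add: coord_def vec_eq_iff forall_3 axis_def)
  finally show ?thesis .
qed

lemma product_invariant_generators:
  assumes "(3 :: 'f::field) \<noteq> 0" "g \<in> generators"
  shows "product (g u) (g v) = g (product u v :: 'f V)"
proof -
  have one: "mon_val (Mon 0 True F0) = (of_base (- 1) :: 'f K)"
    by (simp add: of_base_hom)
  have nine: "mon_val (Mon 2 False F0) = (of_base (- 3) :: 'f K)"
    by (simp add: theta_square of_base_def numeral_K comp_eqs)
  from assms(2) consider "g = gen_a" | "g = gen_b" | "g = gen_c" | "g = gen_d" | "g = gen_e"
    by (auto simp: generators_def)
  then show ?thesis
  proof cases
    case 1
    then show ?thesis
      using product_invariantI[OF one_neq_zero lin_a represents_a one check_a check_antisym] by simp
  next
    case 2
    then show ?thesis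
      using product_invariantI[OF one_neq_zero lin_b represents_b one check_b check_antisym] by simp
  next
    case 3
    then show ?thesis
      using product_invariantI[OF assms(1) lin_c represents_c[OF assms(1)] nine check_c check_antisym]
      by simp
  next
    case 4
    then show ?thesis
      using product_invariantI[OF one_neq_zero lin_d represents_d one check_d check_antisym] by simp
  next
    case 5
    then show ?thesis
      using product_invariantI[OF one_neq_zero lin_e represents_e one check_e check_antisym] by simp
  qed
qed

lemma G_invariantI:
  assumes "generators \<subseteq> carrier (GL_V :: ('f::field V \<Rightarrow> 'f V) monoid)"
    and inv: "\<And>g u v. g \<in> generators \<Longrightarrow> B (g u) (g v) = g (B u v :: 'f V)"
  shows "G_invariant B"
proof -
  have "\<forall>u v. B (g u) (g v) = g (B u v)" if "g \<in> generate GL_V generators" for g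
    using that
  proof induction
    case one
    then show ?case by (simp add: GL_V_def)
  next
    case (incl g)
    then show ?case using inv by blast
  next
    case (inv h)
    let ?h' = "inv\<^bsub>GL_V\<^esub> h"
    interpret group "GL_V :: ('f V \<Rightarrow> 'f V) monoid" by (rule group_GL_V)
    have "h \<in> carrier GL_V" using inv assms(1) by blast
    then have "h \<circ> ?h' = id" "?h' \<circ> h = id"
      using l_inv[of h] r_inv[of h] by (simp_all add: GL_V_def)
    then have hh': "h (?h' v) = v" and h'h: "?h' (h v) = v" for v
      by (simp_all add: fun_eq_iff)
    show ?case
    proof (intro allI)
      fix u v
      have "h (B (?h' u) (?h' v)) = B u v"
        using assms(2)[OF inv, of "?h' u" "?h' v"] by (simp only: hh')
      then show "B (?h' u) (?h' v) = ?h' (B u v)"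
        using h'h by metis
    qed
  next
    case (eng g h)
    then show ?case by (simp add: GL_V_def)
  qed
  then show ?thesis
    by (simp add: G_invariant_def G_def generators_def)
qed

lemma G_invariant_words:
  assumes "G_invariant B" "g \<in> words"
  shows "B (g u) (g v) = g (B u v)"
proof -
  have "B (g u) (g v) = g (B u v)" if "g \<in> generators" for g u v
    using assms(1) generate.incl[of g generators GL_V] that
    by (auto simp: G_invariant_def G_def generators_def)
  with assms(2) show ?thesis
    by (induction arbitrary: u v rule: words.induct) auto
qed

lemma invariant_multiple:
  fixes B B' :: "'f::field V \<Rightarrow> 'f V \<Rightarrow> 'f V"
  assumes B: "invariant_product B" and B': "invariant_product B'"
    and base_value: "invariant_product.base_value B' = scaleV k (invariant_product.base_value B)"
  shows "B' = (\<lambda>u v. scaleV k (B u v))"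
proof -
  interpret B: invariant_product B by (rule B)
  interpret B': invariant_product B' by (rule B')
  have lin: "F_linear g" if "g \<in> words" for g :: "'f V \<Rightarrow> 'f V"
    using that
  proof induction
    case word_id
    show ?case by (rule F_linearI) simp_all
  next
    case (word_step g h)
    then have "F_linear g"
      using lin_a lin_b lin_c lin_d lin_e by (auto simp: generators_def)
    then show ?case
      using word_step.IH by (intro F_linearI) (simp_all add: F_linear_simps)
  qed
  define D where "D u v = B' u v - scaleV k (B u v)" for u v
  have "F_bilinear D"
    unfolding F_bilinear_def D_def
    by (intro conjI allI F_linearI)
       (simp_all add: B.B_simps B'.B_simps scaleV_add scaleV_simps mult.commute)
  then interpret D: invariant_product D
    by unfold_locales
       (simp_all add: B.two B.three D_def B.invariant B'.invariant F_linear_simps[OF lin])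
  have "D.base_value = 0"
    using base_value by (simp add: D.base_value_def B.base_value_def B'.base_value_def D_def)
  then have "D u v = 0" for u v by (rule D.zero_if_base_value_zero)
  then show ?thesis by (simp add: D_def fun_eq_iff)
qed

theorem mainTheorem5:
  fixes p :: nat
  assumes "prime p" "p \<noteq> 2" "p \<noteq> 3" "CHAR('f::field) = p"
  shows "\<exists>B :: 'f V \<Rightarrow> 'f V \<Rightarrow> 'f V.
    F_bilinear B \<and> G_invariant B \<and> B \<noteq> (\<lambda>u v. 0) \<and>
    (\<forall>B'. F_bilinear B' \<and> G_invariant B' \<longrightarrow> (\<exists>k. B' = (\<lambda>u v. scaleV k (B u v)))) \<and>
    B (axis 0 (row3 1 0 0)) (axis 1 (row3 1 0 0)) =
      axis 3 (row3 \<omega>_bar 1 1) - axis 9 (row3 1 \<omega>_bar \<omega>_bar) \<and>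
    (\<forall>B'. F_bilinear B' \<and> G_invariant B' \<and>
        B' (axis 0 (row3 1 0 0)) (axis 1 (row3 1 0 0)) =
          axis 3 (row3 \<omega>_bar 1 1) - axis 9 (row3 1 \<omega>_bar \<omega>_bar)
        \<longrightarrow> B' = B) \<and>
    (\<forall>x y. B x y = - B y x) \<and>
    (\<forall>x y z. B (B x y) z + B (B y z) x + B (B z x) y = 0)"
proof -
  let ?w = "axis 3 (row3 \<omega>_bar 1 1) - axis 9 (row3 1 \<omega>_bar \<omega>_bar) :: 'f V"
  have three: "(3 :: 'f) \<noteq> 0" by (rule three_neq_0[OF assms(1,3,4)])
  have two: "(2 :: 'f) \<noteq> 0"
  proof
    assume "(2 :: 'f) = 0"
    then have "of_nat 2 = (0 :: 'f)" by simp
    then have "p dvd 2" using assms(4) of_nat_eq_0_iff_char_dvd by blast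
    then show False using assms(1,2) primes_dvd_imp_eq[of p 2] by simp
  qed
  have GL: "generators \<subseteq> carrier (GL_V :: ('f V \<Rightarrow> 'f V) monoid)"
    using generators_in_GL_V[OF assms(1,3,4)] by (simp add: generators_def)
  note invariant = product_invariant_generators[OF three]
  have G_product: "G_invariant (product :: 'f V \<Rightarrow> 'f V \<Rightarrow> 'f V)"
    by (rule G_invariantI[OF GL]) (rule invariant)
  have inv_prod: "invariant_product B'" if "F_bilinear B'" "G_invariant B'" for B' :: "'f V \<Rightarrow> 'f V \<Rightarrow> 'f V"
    using that two three by unfold_locales (auto intro: G_invariant_words)
  note inv_prod_product = inv_prod[OF product_bilinear G_product]
  have base_value: "invariant_product.base_value product = ?w"
    unfolding invariant_product.base_value_def[OF inv_prod_product] by (rule product_value)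
  have unique: "B' = (\<lambda>u v. scaleV k (product u v))"
    if "F_bilinear B'" "G_invariant B'" "B' (axis 0 (row3 1 0 0)) (axis 1 (row3 1 0 0)) = scaleV k ?w"
    for B' :: "'f V \<Rightarrow> 'f V \<Rightarrow> 'f V" and k
  proof (rule invariant_multiple[OF inv_prod_product inv_prod[OF that(1,2)]])
    show "invariant_product.base_value B' = scaleV k (invariant_product.base_value product)"
      unfolding base_value invariant_product.base_value_def[OF inv_prod[OF that(1,2)]] by (rule that(3))
  qed
  have multiple: "\<exists>k. B' = (\<lambda>u v. scaleV k (product u v))" if "F_bilinear B'" "G_invariant B'"
    for B' :: "'f V \<Rightarrow> 'f V \<Rightarrow> 'f V"
  proof -
    interpret invariant_product B' by (rule inv_prod[OF that])
    obtain k where "base_value = scaleV k ?w" by (rule base_value_shape)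
    then show ?thesis using unique[OF that] unfolding base_value_def by blast
  qed
  have "?w $ 3 $ 2 = 1" by (simp add: axis_def)
  then have "?w \<noteq> 0" by (metis zero_index zero_neq_one)
  then have "product \<noteq> (\<lambda>u v. 0 :: 'f V)"
    using product_value by metis
  moreover have "product x y = - product y x" for x y :: "'f V"
    by (rule product_antisym[OF check_antisym])
  moreover have "jacobiator x y z = 0" for x y z :: "'f V"
    using GL by (intro jacobi three invariant) (auto simp: GL_V_def)
  then have "product (product x y) z + product (product y z) x + product (product z x) y = 0"
    for x y z :: "'f V"
    by (simp only: jacobiator_def)
  moreover have "B' = product" if "F_bilinear B'" "G_invariant B'"
    "B' (axis 0 (row3 1 0 0)) (axis 1 (row3 1 0 0)) = ?w"
    for B' :: "'f V \<Rightarrow> 'f V \<Rightarrow> 'f V"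
    using unique[of B' 1] that by (simp add: scaleV_simps)
  ultimately show ?thesis
    using product_bilinear G_product product_value multiple by blast
qed

end
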